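(* Let $R$ be a Noetherian integral domain. Let $\mathrm{cl}$ be a functorial closure operation on the set of pairs $\mathcal P:=\{(M,P)\mid P\text{ is a finitely generated projective }R\text{-module and }M\text{ is a submodule of }P\}$. Suppose that whenever $\alpha:M\hookrightarrow P$ and $\beta:M\hookrightarrow Q$ are injective maps where $P,Q$ are finitely generated projective modules, then for any submodule $L$ of $M$ we have $\alpha^{-1}(\alpha(L)^{\mathrm{cl}}_P)=\beta^{-1}(\beta(L)^{\mathrm{cl}}_Q)$. Let $\mathcal Q$ be the class of finitely generated projective $R$-modules. Then the closure operation $\mathrm{cl}_{h(\mathcal Q)}$ on $\mathcal P':=\{(L,M)\mid L\subseteq M,\ M\text{ finitely generated}\}$ is hereditary. Consequently, it is equal to its hereditary version.
   Context: A closure operation assigns to each pair $L\subseteq M$ in its domain a submodule $L^{\mathrm{cl}}_M$ of $M$, compatibly with isomorphisms, such that $L\subseteq L^{\mathrm{cl}}_M$; $L^{\mathrm{cl}}_M\subseteq N^{\mathrm{cl}}_M$ for $L\subseteq N\subseteq M$; and $(L^{\mathrm{cl}}_M)^{\mathrm{cl}}_M=L^{\mathrm{cl}}_M$. It is functorial if $g(L^{\mathrm{cl}}_M)\subseteq g(L)^{\mathrm{cl}}_{M'}$ for every $R$-linear $g:M\to M'$ (with both pairs in the domain), and hereditary if $L^{\mathrm{cl}}_N=L^{\mathrm{cl}}_M\cap N$ for all $L\subseteq N\subseteq M$ with $(L,N),(L,M)$ in the domain. For a finitely generated $R$-module $M$, a $\mathcal Q$-preenvelope is an $R$-linear map $\alpha:M\to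 C$ with $C\in\mathcal Q$ such that every $R$-linear map $M\to D$ with $D\in\mathcal Q$ factors through $\alpha$; these exist over a Noetherian ring. The closure operation $\mathrm{cl}_{h(\mathcal Q)}$ on pairs of finitely generated modules is defined by $L^{\mathrm{cl}_{h(\mathcal Q)}}_M:=\alpha^{-1}(\alpha(L)^{\mathrm{cl}}_C)$ for any $\mathcal Q$-preenvelope $\alpha:M\to C$ (well-defined); equivalently, it consists of those $x\in M$ with $g(x)\in g(L)^{\mathrm{cl}}_D$ for all $g:M\to D$ with $D\in\mathcal Q$. Hereditary version: for a closure operation $d$ on finitely generated modules, extend $d$ to all $R$-modules by its finitistic version $L^{d_f}_M=\bigcup\{(L\cap U)^d_U\mid U\subseteq M\text{ finitely generated}\}$; the hereditary version is then $L\subseteq M\mapsto L^{d_f}_E\cap M$, for $E$ an injective module containing $M$. *)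

theory Defs
  imports "HOL-Algebra.Module" "HOL-Algebra.Ring_Divisibility"
begin

text \<open>
  All modules have their elements in one type \<open>'m\<close>, which plays the role of the universe.
  A submodule \<open>N\<close> of \<open>M\<close> is the module \<open>M\<lparr>carrier := N\<rparr>\<close>.
  The record type of modules also has the fields \<^const>\<open>mult\<close> and \<^const>\<open>one\<close>, which are
  meaningless for modules.  Modules that differ only there, or in the behaviour of the operations
  outside the carrier, are isomorphic by the identity, so closure operations do not see
  the difference.
\<close>

definition mod_hom ::
    "('a, 'b) ring_scheme \<Rightarrow> ('a, 'm) module \<Rightarrow> ('a, 'm) module \<Rightarrow> ('m \<Rightarrow> 'm) set" where
  "mod_hom R M N = {f \<in> carrier M \<rightarrow> carrier N.
     (\<forall>x\<in>carrier M. \<forall>y\<in>carrier M. f (x \<oplus>\<^bsub>M\<^esub> y) = f x \<oplus>\<^bsub>N\<^esub> f y) \<and>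
     (\<forall>r\<in>carrier R. \<forall>x\<in>carrier M. f (r \<odot>\<^bsub>M\<^esub> x) = r \<odot>\<^bsub>N\<^esub> f x)}"

definition fin_gen :: "('a, 'b) ring_scheme \<Rightarrow> ('a, 'm) module \<Rightarrow> bool" where
  "fin_gen R M \<longleftrightarrow> module R M \<and>
     (\<exists>S. finite S \<and> S \<subseteq> carrier M \<and> (\<forall>N. submodule N R M \<and> S \<subseteq> N \<longrightarrow> N = carrier M))"

text \<open>
  The test modules in the lifting and extension properties range over the universe \<open>'m\<close>.
  If \<open>'m\<close> is infinite and at least as large as \<open>R\<close>, then it has room for copies of all modules
  \<open>R\<^sup>n\<close> and all ideals of \<open>R\<close>.  Hence \<open>projective\<close> is correct for finitely generated modules
  (split an epimorphism from some \<open>R\<^sup>n\<close>), and \<open>injective\<close> is correct by Baer's criterion.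
\<close>

definition projective :: "('a, 'b) ring_scheme \<Rightarrow> ('a, 'm) module \<Rightarrow> bool" where
  "projective R P \<longleftrightarrow> module R P \<and>
     (\<forall>(A :: ('a, 'm) module) (B :: ('a, 'm) module). \<forall>f\<in>mod_hom R A B. \<forall>g\<in>mod_hom R P B.
        module R A \<and> module R B \<and> f ` carrier A = carrier B \<longrightarrow>
        (\<exists>h\<in>mod_hom R P A. \<forall>x\<in>carrier P. f (h x) = g x))"

definition injective :: "('a, 'b) ring_scheme \<Rightarrow> ('a, 'm) module \<Rightarrow> bool" where
  "injective R E \<longleftrightarrow> module R E \<and>
     (\<forall>(A :: ('a, 'm) module) (B :: ('a, 'm) module). \<forall>f\<in>mod_hom R A B. \<forall>g\<in>mod_hom R A E.
        module R A \<and> module R B \<and> inj_on f (carrier A) \<longrightarrow>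
        (\<exists>h\<in>mod_hom R B E. \<forall>x\<in>carrier A. h (f x) = g x))"

definition fg_projective :: "('a, 'b) ring_scheme \<Rightarrow> ('a, 'm) module \<Rightarrow> bool" where
  "fg_projective R P \<longleftrightarrow> fin_gen R P \<and> projective R P"

text \<open>
  For a class \<open>D\<close> of modules, a closure operation with domain
  \<open>{(L, M). M \<in> D, L \<subseteq> M a submodule}\<close>.  The closure of \<open>L\<close> in \<open>M\<close> is \<open>cl M L\<close>;
  the values of \<open>cl\<close> outside the domain are irrelevant.
\<close>

definition closure_operation ::
    "('a, 'b) ring_scheme \<Rightarrow> (('a, 'm) module \<Rightarrow> bool) \<Rightarrow>
     (('a, 'm) module \<Rightarrow> 'm set \<Rightarrow> 'm set) \<Rightarrow> bool" where
  "closure_operation R D cl \<longleftrightarrow>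
     (\<forall>M L. D M \<and> submodule L R M \<longrightarrow>
        submodule (cl M L) R M \<and> L \<subseteq> cl M L \<and> cl M (cl M L) = cl M L) \<and>
     (\<forall>M L N. D M \<and> submodule L R M \<and> submodule N R M \<and> L \<subseteq> N \<longrightarrow> cl M L \<subseteq> cl M N) \<and>
     (\<forall>M M' L f. D M \<and> D M' \<and> submodule L R M \<and>
        f \<in> mod_hom R M M' \<and> bij_betw f (carrier M) (carrier M') \<longrightarrow>
        f ` cl M L = cl M' (f ` L))"

definition functorial_closure ::
    "('a, 'b) ring_scheme \<Rightarrow> (('a, 'm) module \<Rightarrow> bool) \<Rightarrow>
     (('a, 'm) module \<Rightarrow> 'm set \<Rightarrow> 'm set) \<Rightarrow> bool" where
  "functorial_closure R D cl \<longleftrightarrow>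
     (\<forall>M M' L. \<forall>g\<in>mod_hom R M M'. D M \<and> D M' \<and> submodule L R M \<longrightarrow>
        g ` cl M L \<subseteq> cl M' (g ` L))"

definition hereditary_closure ::
    "('a, 'b) ring_scheme \<Rightarrow> (('a, 'm) module \<Rightarrow> bool) \<Rightarrow>
     (('a, 'm) module \<Rightarrow> 'm set \<Rightarrow> 'm set) \<Rightarrow> bool" where
  "hereditary_closure R D cl \<longleftrightarrow>
     (\<forall>M N L. D M \<and> submodule N R M \<and> D (M\<lparr>carrier := N\<rparr>) \<and> submodule L R M \<and> L \<subseteq> N \<longrightarrow>
        cl (M\<lparr>carrier := N\<rparr>) L = cl M L \<inter> N)"

definition preenvelope ::
    "('a, 'b) ring_scheme \<Rightarrow> (('a, 'm) module \<Rightarrow> bool) \<Rightarrow>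
     ('a, 'm) module \<Rightarrow> ('a, 'm) module \<Rightarrow> ('m \<Rightarrow> 'm) \<Rightarrow> bool" where
  "preenvelope R Q M C \<alpha> \<longleftrightarrow> Q C \<and> \<alpha> \<in> mod_hom R M C \<and>
     (\<forall>D. \<forall>g\<in>mod_hom R M D. Q D \<longrightarrow>
        (\<exists>h\<in>mod_hom R C D. \<forall>x\<in>carrier M. g x = h (\<alpha> x)))"

text \<open>The choice of the preenvelope does not matter: see \<open>preenvelope_closure_eq\<close> below.\<close>

definition preenvelope_closure ::
    "('a, 'b) ring_scheme \<Rightarrow> (('a, 'm) module \<Rightarrow> bool) \<Rightarrow>
     (('a, 'm) module \<Rightarrow> 'm set \<Rightarrow> 'm set) \<Rightarrow> ('a, 'm) module \<Rightarrow> 'm set \<Rightarrow> 'm set" where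
  "preenvelope_closure R Q cl M L =
     (let (C, \<alpha>) = SOME (C, \<alpha>). preenvelope R Q M C \<alpha>
      in {x \<in> carrier M. \<alpha> x \<in> cl C (\<alpha> ` L)})"

definition finitistic_version ::
    "('a, 'b) ring_scheme \<Rightarrow> (('a, 'm) module \<Rightarrow> 'm set \<Rightarrow> 'm set) \<Rightarrow>
     ('a, 'm) module \<Rightarrow> 'm set \<Rightarrow> 'm set" where
  "finitistic_version R d M L =
     \<Union> {d (M\<lparr>carrier := U\<rparr>) (L \<inter> U) | U. submodule U R M \<and> fin_gen R (M\<lparr>carrier := U\<rparr>)}"

text \<open>
  The hereditary version of \<open>d\<close>, computed in the module \<open>E\<close> (to be taken injective) that contains
  \<open>M\<close> via the embedding \<open>i\<close>; for a literal inclusion, \<open>i\<close> is the identity and the result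
  is \<open>finitistic_version R d E L \<inter> M\<close>.
\<close>

definition hereditary_version ::
    "('a, 'b) ring_scheme \<Rightarrow> (('a, 'm) module \<Rightarrow> 'm set \<Rightarrow> 'm set) \<Rightarrow>
     ('a, 'm) module \<Rightarrow> ('m \<Rightarrow> 'm) \<Rightarrow> ('a, 'm) module \<Rightarrow> 'm set \<Rightarrow> 'm set" where
  "hereditary_version R d E i M L = {x \<in> carrier M. i x \<in> finitistic_version R d E (i ` L)}"

lemma mod_hom_image_submodule:
  assumes M: "module R M" and N: "module R N" and f: "f \<in> mod_hom R M N"
    and L: "submodule L R M"
  shows "submodule (f ` L) R N"
proof -
  interpret M: module R M by fact
  interpret N: module R N by fact
  note Ls = M.submoduleE[OF L]
  have Lsub: "x \<in> carrier M" if "x \<in> L" for x using Ls(1) that by auto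
  have fc: "f x \<in> carrier N" if "x \<in> carrier M" for x using f that by (auto simp: mod_hom_def)
  have fa: "f (x \<oplus>\<^bsub>M\<^esub> y) = f x \<oplus>\<^bsub>N\<^esub> f y" if "x \<in> carrier M" "y \<in> carrier M" for x y
    using f that by (auto simp: mod_hom_def)
  have fs: "f (r \<odot>\<^bsub>M\<^esub> x) = r \<odot>\<^bsub>N\<^esub> f x" if "r \<in> carrier R" "x \<in> carrier M" for r x
    using f that by (auto simp: mod_hom_def)
  obtain z where z: "z \<in> L" using Ls(2) by blast
  have "\<zero>\<^bsub>R\<^esub> \<odot>\<^bsub>N\<^esub> f z \<in> f ` L"
    using fs[of "\<zero>\<^bsub>R\<^esub>" z] Ls(4)[of "\<zero>\<^bsub>R\<^esub>" z] z Lsub by (metis M.R.zero_closed imageI)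
  then have z0: "\<zero>\<^bsub>N\<^esub> \<in> f ` L" using fc[OF Lsub[OF z]] by simp
  have neg: "\<ominus>\<^bsub>N\<^esub> a \<in> f ` L" if "a \<in> f ` L" for a
  proof -
    obtain x where x: "x \<in> L" "a = f x" using \<open>a \<in> f ` L\<close> by blast
    have "\<ominus>\<^bsub>N\<^esub> a = (\<ominus>\<^bsub>R\<^esub> \<one>\<^bsub>R\<^esub>) \<odot>\<^bsub>N\<^esub> f x"
      using N.smult_l_minus[of "\<one>\<^bsub>R\<^esub>" "f x"] fc[OF Lsub[OF x(1)]] x by simp
    also have "\<dots> = f ((\<ominus>\<^bsub>R\<^esub> \<one>\<^bsub>R\<^esub>) \<odot>\<^bsub>M\<^esub> x)" using fs Lsub x by simp
    finally show ?thesis using Ls(4) x by auto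
  qed
  show ?thesis
  proof (rule N.submoduleI)
    show "f ` L \<subseteq> carrier N" using fc Lsub by auto
    show "\<And>a b. a \<in> f ` L \<Longrightarrow> b \<in> f ` L \<Longrightarrow> a \<oplus>\<^bsub>N\<^esub> b \<in> f ` L"
      using fa Lsub Ls(5) by (smt (verit) image_iff)
    show "\<And>a x. a \<in> carrier R \<Longrightarrow> x \<in> f ` L \<Longrightarrow> a \<odot>\<^bsub>N\<^esub> x \<in> f ` L"
      using fs Lsub Ls(4) by (smt (verit) image_iff)
  qed (use z0 neg in auto)
qed

lemma preenvelope_closure_eq:
  assumes Q: "\<And>P. Q P \<Longrightarrow> module R P" and fn: "functorial_closure R Q cl"
    and M: "module R M" and L: "submodule L R M" and a: "preenvelope R Q M C \<alpha>"
  shows "preenvelope_closure R Q cl M L = {x \<in> carrier M. \<alpha> x \<in> cl C (\<alpha> ` L)}"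
proof -
  have sub: "{x \<in> carrier M. \<alpha> x \<in> cl C (\<alpha> ` L)} \<subseteq> {x \<in> carrier M. \<beta> x \<in> cl D (\<beta> ` L)}"
    if a: "preenvelope R Q M C \<alpha>" and b: "preenvelope R Q M D \<beta>" for C \<alpha> D \<beta>
  proof -
    obtain h where h: "h \<in> mod_hom R C D" "\<And>x. x \<in> carrier M \<Longrightarrow> \<beta> x = h (\<alpha> x)"
      using a b unfolding preenvelope_def by blast
    have LM: "L \<subseteq> carrier M" using module.submoduleE(1)[OF M L] .
    have "submodule (\<alpha> ` L) R C"
      using mod_hom_image_submodule[OF M _ _ L] a Q unfolding preenvelope_def by blast
    then have "h ` cl C (\<alpha> ` L) \<subseteq> cl D (h ` (\<alpha> ` L))"
      using fn h a b unfolding functorial_closure_def preenvelope_def by blast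
    moreover have "h ` (\<alpha> ` L) = \<beta> ` L" using h(2) LM by (force simp: image_iff)
    ultimately show ?thesis using h(2) by auto
  qed
  obtain D \<beta> where e: "(SOME (C, \<alpha>). preenvelope R Q M C \<alpha>) = (D, \<beta>)" by force
  have "case (SOME (C, \<alpha>). preenvelope R Q M C \<alpha>) of (C, \<alpha>) \<Rightarrow> preenvelope R Q M C \<alpha>"
    by (rule someI[where x = "(C, \<alpha>)"]) (simp add: a)
  then have b: "preenvelope R Q M D \<beta>" using e by simp
  show ?thesis
    unfolding preenvelope_closure_def e using sub[OF a b] sub[OF b a] by auto
qed

end

theory Submission
  imports Defs
begin

text \<open>
  Over a Noetherian ring the dual of a finitely generated module \<open>M\<close> is generated by finitely many
  forms, and these are the coordinates of a preenvelope \<open>M \<rightarrow> R\<^sup>k\<close>.  Over a domain its kernel is the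
  torsion of \<open>M\<close>.  For \<open>N \<subseteq> M\<close> the torsion of \<open>N\<close> is that of \<open>M\<close> intersected with \<open>N\<close>, so the
  preenvelope \<open>\<beta>\<close> of \<open>N\<close> and the restriction to \<open>N\<close> of the preenvelope \<open>\<alpha>\<close> of \<open>M\<close> have the same
  kernel.  Hence \<open>\<beta>\<close> factors through an injective map on \<open>\<alpha>(N)\<close>, and the independence of the
  embedding, applied to \<open>\<alpha>(N)\<close>, shows that the two closures agree on \<open>N\<close>.  For the hereditary
  version, a finitely generated submodule \<open>U\<close> of \<open>E\<close> is enlarged to \<open>U + M\<close>.
\<close>

text \<open>The obstacle is that the restriction of \<alpha> to N need not be a preenvelope of N: on
  2Z inside Z, the form with 2 |-> 1 does not extend to Z. The restriction does factor through
  \<beta>, so functoriality alone puts the closure in N inside the closure in M; the reverse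
  inclusion has to come from the independence of the embedding. That hypothesis concerns injective
  maps into projective modules, and over a domain a module with torsion has none, so it cannot be
  applied to N itself. It applies to \<alpha>(N), once \<beta> is known to descend to an injective
  map there; describing both kernels intrinsically, as torsion, supplies this. Forms kill torsion
  because R has no zero divisors. That nothing else is killed by all forms would usually be read off
  after tensoring with the fraction field. Here a form is built on the multiples of a non-torsion
  element and extended generator by generator, which never leaves R. A second concern is the
  universe: preenvelopes must have their elements in \<open>'m\<close>, so a copy of each R^k is
  encoded there.\<close>

section \<open>Linear maps and submodules\<close>

definition lin_map ::
    "('a, 'b) ring_scheme \<Rightarrow> ('a, 'm) module \<Rightarrow> ('a, 'n) module \<Rightarrow> ('m \<Rightarrow> 'n) set" where
  "lin_map R M N = {f \<in> carrier M \<rightarrow> carrier N.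
     (\<forall>x\<in>carrier M. \<forall>y\<in>carrier M. f (x \<oplus>\<^bsub>M\<^esub> y) = f x \<oplus>\<^bsub>N\<^esub> f y) \<and>
     (\<forall>r\<in>carrier R. \<forall>x\<in>carrier M. f (r \<odot>\<^bsub>M\<^esub> x) = r \<odot>\<^bsub>N\<^esub> f x)}"

text \<open>\<open>mod_hom\<close> keeps source and target in one element type. Linear forms take
  values in \<open>'a\<close>, so the general facts are proved for \<open>lin_map\<close> and
  transferred through this equation.\<close>

lemma mod_hom_eq_lin_map: "mod_hom R M N = lin_map R M N"
  by (simp add: mod_hom_def lin_map_def)

lemma lin_mapI:
  assumes "\<And>x. x \<in> carrier M \<Longrightarrow> f x \<in> carrier N"
    and "\<And>x y. x \<in> carrier M \<Longrightarrow> y \<in> carrier M \<Longrightarrow> f (x \<oplus>\<^bsub>M\<^esub> y) = f x \<oplus>\<^bsub>N\<^esub> f y"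
    and "\<And>r x. r \<in> carrier R \<Longrightarrow> x \<in> carrier M \<Longrightarrow> f (r \<odot>\<^bsub>M\<^esub> x) = r \<odot>\<^bsub>N\<^esub> f x"
  shows "f \<in> lin_map R M N"
  using assms by (simp add: lin_map_def)

lemma lin_mapD:
  assumes "f \<in> lin_map R M N"
  shows lin_map_closed: "x \<in> carrier M \<Longrightarrow> f x \<in> carrier N"
    and lin_map_add: "x \<in> carrier M \<Longrightarrow> y \<in> carrier M \<Longrightarrow> f (x \<oplus>\<^bsub>M\<^esub> y) = f x \<oplus>\<^bsub>N\<^esub> f y"
    and lin_map_smult: "r \<in> carrier R \<Longrightarrow> x \<in> carrier M \<Longrightarrow> f (r \<odot>\<^bsub>M\<^esub> x) = r \<odot>\<^bsub>N\<^esub> f x"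
  using assms by (auto simp: lin_map_def)

lemma lin_map_compose:
  assumes "f \<in> lin_map R M N" and "g \<in> lin_map R N P"
  shows "(\<lambda>x. g (f x)) \<in> lin_map R M P"
  by (rule lin_mapI) (simp_all add: lin_mapD[OF assms(1)] lin_mapD[OF assms(2)])

lemma lin_map_id: "(\<lambda>x. x) \<in> lin_map R M M"
  by (simp add: lin_map_def)

lemma lin_map_zero:
  assumes "module R M" and "module R N" and f: "f \<in> lin_map R M N"
  shows "f \<zero>\<^bsub>M\<^esub> = \<zero>\<^bsub>N\<^esub>"
proof -
  interpret M: module R M by fact
  interpret N: module R N by fact
  have "f \<zero>\<^bsub>M\<^esub> = f (\<zero>\<^bsub>R\<^esub> \<odot>\<^bsub>M\<^esub> \<zero>\<^bsub>M\<^esub>)" by simp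
  also have "\<dots> = \<zero>\<^bsub>R\<^esub> \<odot>\<^bsub>N\<^esub> f \<zero>\<^bsub>M\<^esub>" by (rule lin_map_smult[OF f]) auto
  finally show ?thesis using lin_map_closed[OF f] by simp
qed

lemma lin_map_restrict:
  assumes "f \<in> lin_map R M P" and "N \<subseteq> carrier M"
  shows "f \<in> lin_map R (M\<lparr>carrier := N\<rparr>) P"
  using assms by (fastforce simp: lin_map_def)

lemma lin_map_corestrict:
  assumes "f \<in> lin_map R M P" and "f ` carrier M \<subseteq> K"
  shows "f \<in> lin_map R M (P\<lparr>carrier := K\<rparr>)"
  using assms by (fastforce simp: lin_map_def)

text \<open>Negation is multiplication by the scalar \<open>\<ominus> \<one>\<close>, so closure
  under it comes from closure under scalars.\<close>

lemma (in module) submoduleI':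
  assumes "H \<subseteq> carrier M" and "\<zero>\<^bsub>M\<^esub> \<in> H"
    and "\<And>a b. \<lbrakk>a \<in> H; b \<in> H\<rbrakk> \<Longrightarrow> a \<oplus>\<^bsub>M\<^esub> b \<in> H"
    and s: "\<And>a x. \<lbrakk>a \<in> carrier R; x \<in> H\<rbrakk> \<Longrightarrow> a \<odot>\<^bsub>M\<^esub> x \<in> H"
  shows "submodule H R M"
proof (rule submoduleI)
  fix a assume "a \<in> H"
  then have "a \<in> carrier M" using assms(1) by blast
  then have "\<ominus>\<^bsub>M\<^esub> a = (\<ominus>\<^bsub>R\<^esub> \<one>\<^bsub>R\<^esub>) \<odot>\<^bsub>M\<^esub> a" by (simp add: smult_l_minus)
  then show "\<ominus>\<^bsub>M\<^esub> a \<in> H" using s[of "\<ominus>\<^bsub>R\<^esub> \<one>\<^bsub>R\<^esub>" a] \<open>a \<in> H\<close> by simp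
qed (use assms in auto)

lemma (in module) submodule_zero_closed:
  assumes "submodule H R M"
  shows "\<zero>\<^bsub>M\<^esub> \<in> H"
proof -
  interpret submodule H R M by fact
  show ?thesis using one_closed by simp
qed

lemma submodule_vimage:
  assumes "module R M" and "module R N" and f: "f \<in> lin_map R M N" and K: "submodule K R N"
  shows "submodule {x \<in> carrier M. f x \<in> K} R M"
proof -
  interpret M: module R M by fact
  interpret N: module R N by fact
  show ?thesis
    by (rule M.submoduleI')
      (auto simp: lin_mapD[OF f] lin_map_zero[OF assms(1-3)] N.submodule_zero_closed[OF K]
        N.submoduleE[OF K])
qed

text \<open>Stands in for expansions in generators: \<open>fin_gen\<close> speaks of submodules
  containing the generators, so two maps that agree on generators agree everywhere.\<close>

lemma submodule_equalizer:
  assumes "module R M" and "module R N" and f: "f \<in> lin_map R M N" and g: "g \<in> lin_map R M N"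
  shows "submodule {x \<in> carrier M. f x = g x} R M"
proof -
  interpret M: module R M by fact
  interpret N: module R N by fact
  show ?thesis
    by (rule M.submoduleI')
      (auto simp: lin_mapD[OF f] lin_mapD[OF g] lin_map_zero[OF assms(1,2)] f g)
qed

lemma submodule_restrict:
  assumes M: "module R M" and L: "submodule L R M" and N: "submodule N R M" and "L \<subseteq> N"
  shows "submodule L R (M\<lparr>carrier := N\<rparr>)"
proof -
  interpret M: module R M by fact
  interpret N: module R "M\<lparr>carrier := N\<rparr>" by (rule submodule.submodule_is_module[OF N M])
  show ?thesis
    by (rule N.submoduleI')
      (use \<open>L \<subseteq> N\<close> M.submoduleE[OF L] M.submodule_zero_closed[OF L] in auto)
qed

section \<open>R^k as a product and as a coproduct\<close>

definition self_module :: "('a, 'b) ring_scheme \<Rightarrow> ('a, 'a) module" where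
  "self_module R = \<lparr>carrier = carrier R, mult = mult R, one = one R, zero = zero R, add = add R,
     smult = mult R\<rparr>"

lemma self_module_simps [simp]:
  "carrier (self_module R) = carrier R" "zero (self_module R) = zero R"
  "add (self_module R) = add R" "smult (self_module R) = mult R"
  by (simp_all add: self_module_def)

lemma (in cring) module_self_module: "module R (self_module R)"
proof (rule moduleI)
  show "abelian_group (self_module R)"
    by (rule abelian_groupI) (auto simp: a_ac intro!: bexI[of _ "\<ominus> x" for x] l_neg)
qed (auto simp: m_assoc l_distr r_distr intro: is_cring)

abbreviation linear_forms where "linear_forms R M \<equiv> lin_map R M (self_module R)"

text \<open>
  \<open>F\<close> is isomorphic to \<open>R\<^sup>k\<close> via the forms \<open>p 0, \<dots>, p (k - 1)\<close>.  The module \<open>R\<^sup>k\<close> is only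
  characterized, since a copy of it is needed inside the type \<open>'m\<close>.
\<close>

definition coordinates ::
    "('a, 'b) ring_scheme \<Rightarrow> nat \<Rightarrow> ('a, 'm) module \<Rightarrow> (nat \<Rightarrow> 'm \<Rightarrow> 'a) \<Rightarrow> bool" where
  "coordinates R k F p \<longleftrightarrow> module R F \<and> (\<forall>i<k. p i \<in> linear_forms R F) \<and>
     (\<forall>c\<in>{..<k} \<rightarrow> carrier R. \<exists>!x. x \<in> carrier F \<and> (\<forall>i<k. p i x = c i))"

lemma coordinatesD:
  assumes "coordinates R k F p"
  shows coordinates_module: "module R F"
    and coordinates_form: "i < k \<Longrightarrow> p i \<in> linear_forms R F"
    and coordinates_closed: "i < k \<Longrightarrow> x \<in> carrier F \<Longrightarrow> p i x \<in> carrier R"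
    and coordinates_ex1: "(\<And>i. i < k \<Longrightarrow> c i \<in> carrier R) \<Longrightarrow>
      \<exists>!x. x \<in> carrier F \<and> (\<forall>i<k. p i x = c i)"
proof -
  show p: "i < k \<Longrightarrow> p i \<in> linear_forms R F" for i
    using assms by (simp add: coordinates_def)
  show "i < k \<Longrightarrow> x \<in> carrier F \<Longrightarrow> p i x \<in> carrier R"
    using lin_map_closed[OF p] by simp
  assume "\<And>i. i < k \<Longrightarrow> c i \<in> carrier R"
  then have "c \<in> {..<k} \<rightarrow> carrier R" by simp
  then show "\<exists>!x. x \<in> carrier F \<and> (\<forall>i<k. p i x = c i)"
    using assms unfolding coordinates_def by (elim conjE bspec)
qed (use assms in \<open>simp add: coordinates_def\<close>)

lemma coordinates_eqI:
  assumes F: "coordinates R k F p" and "x \<in> carrier F" and y: "y \<in> carrier F"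
    and "\<And>i. i < k \<Longrightarrow> p i x = p i y"
  shows "x = y"
proof -
  have "\<exists>!x. x \<in> carrier F \<and> (\<forall>i<k. p i x = p i y)"
    by (rule coordinates_ex1[OF F]) (rule coordinates_closed[OF F _ y])
  then show ?thesis by (rule ex1E) (use assms in metis)
qed

text \<open>The product property of R^k. The coordinates determine \<open>h x\<close>, and
  \<open>h\<close> is linear because both sides of each required equation have the same
  coordinates.\<close>

lemma coordinates_product:
  assumes F: "coordinates R k F p" and M: "module R M"
    and g: "\<And>i. i < k \<Longrightarrow> g i \<in> linear_forms R M"
  obtains h where "h \<in> lin_map R M F" and "\<And>x i. x \<in> carrier M \<Longrightarrow> i < k \<Longrightarrow> p i (h x) = g i x"
proof -
  interpret M: module R M by fact
  interpret F: module R F by (rule coordinates_module[OF F])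
  note p = coordinates_form[OF F]
  have "\<exists>y. y \<in> carrier F \<and> (\<forall>i<k. p i y = g i x)" if "x \<in> carrier M" for x
  proof (rule ex1_implies_ex, rule coordinates_ex1[OF F])
    fix i assume "i < k"
    then show "g i x \<in> carrier R" using lin_map_closed[OF g that] by simp
  qed
  then have "\<forall>x\<in>carrier M. \<exists>y. y \<in> carrier F \<and> (\<forall>i<k. p i y = g i x)" by (rule ballI)
  from bchoice[OF this] obtain h where "\<forall>x\<in>carrier M. h x \<in> carrier F \<and> (\<forall>i<k. p i (h x) = g i x)"
    by (elim exE)
  then have h: "\<And>x. x \<in> carrier M \<Longrightarrow> h x \<in> carrier F"
    "\<And>x i. x \<in> carrier M \<Longrightarrow> i < k \<Longrightarrow> p i (h x) = g i x" by blast+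
  have "h \<in> lin_map R M F"
    by (rule lin_mapI; (rule coordinates_eqI[OF F])?)
      (simp_all add: h lin_mapD[OF p] lin_mapD[OF g])
  then show ?thesis using h(2) that by blast
qed

lemma lin_map_sum:
  assumes M: "module R M" and N: "module R N" and I: "finite I"
    and f: "\<And>i. i \<in> I \<Longrightarrow> f i \<in> linear_forms R M" and v: "\<And>i. i \<in> I \<Longrightarrow> v i \<in> carrier N"
  shows "(\<lambda>x. \<Oplus>\<^bsub>N\<^esub>i\<in>I. f i x \<odot>\<^bsub>N\<^esub> v i) \<in> lin_map R M N"
proof -
  interpret M: module R M by fact
  interpret N: module R N by fact
  have fc: "f i x \<in> carrier R" if "i \<in> I" "x \<in> carrier M" for i x
    using lin_map_closed[OF f] that by fastforce
  show ?thesis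
  proof (rule lin_mapI)
    fix x y assume xy: "x \<in> carrier M" "y \<in> carrier M"
    have "(\<Oplus>\<^bsub>N\<^esub>i\<in>I. f i (x \<oplus>\<^bsub>M\<^esub> y) \<odot>\<^bsub>N\<^esub> v i) = (\<Oplus>\<^bsub>N\<^esub>i\<in>I. f i x \<odot>\<^bsub>N\<^esub> v i \<oplus>\<^bsub>N\<^esub> f i y \<odot>\<^bsub>N\<^esub> v i)"
      using xy by (intro N.finsum_cong') (auto simp: lin_map_add[OF f] N.smult_l_distr fc v)
    then show "(\<Oplus>\<^bsub>N\<^esub>i\<in>I. f i (x \<oplus>\<^bsub>M\<^esub> y) \<odot>\<^bsub>N\<^esub> v i) =
        (\<Oplus>\<^bsub>N\<^esub>i\<in>I. f i x \<odot>\<^bsub>N\<^esub> v i) \<oplus>\<^bsub>N\<^esub> (\<Oplus>\<^bsub>N\<^esub>i\<in>I. f i y \<odot>\<^bsub>N\<^esub> v i)"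
      using xy by (subst N.finsum_addf[symmetric]) (auto simp: fc v)
  next
    fix r x assume rx: "r \<in> carrier R" "x \<in> carrier M"
    have "(\<Oplus>\<^bsub>N\<^esub>i\<in>I. f i (r \<odot>\<^bsub>M\<^esub> x) \<odot>\<^bsub>N\<^esub> v i) = (\<Oplus>\<^bsub>N\<^esub>i\<in>I. r \<odot>\<^bsub>N\<^esub> (f i x \<odot>\<^bsub>N\<^esub> v i))"
      using rx by (intro N.finsum_cong') (auto simp: lin_map_smult[OF f] N.smult_assoc1 fc v)
    then show "(\<Oplus>\<^bsub>N\<^esub>i\<in>I. f i (r \<odot>\<^bsub>M\<^esub> x) \<odot>\<^bsub>N\<^esub> v i) = r \<odot>\<^bsub>N\<^esub> (\<Oplus>\<^bsub>N\<^esub>i\<in>I. f i x \<odot>\<^bsub>N\<^esub> v i)"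
      using rx by (subst N.finsum_smult_ldistr[OF I]) (auto simp: fc v)
  qed (auto intro!: N.finsum_closed simp: fc v)
qed

lemma lin_map_finsum:
  assumes M: "module R M" and N: "module R N" and I: "finite I"
    and f: "f \<in> lin_map R M N" and v: "\<And>i. i \<in> I \<Longrightarrow> v i \<in> carrier M"
  shows "f (\<Oplus>\<^bsub>M\<^esub>i\<in>I. v i) = (\<Oplus>\<^bsub>N\<^esub>i\<in>I. f (v i))"
proof -
  interpret M: module R M by fact
  interpret N: module R N by fact
  show ?thesis
    using I v
    by (induction I rule: finite_induct)
      (simp_all add: lin_map_zero[OF M N f] lin_mapD[OF f] Pi_def)
qed

lemma (in module) submodule_finsum_closed:
  assumes "submodule K R M" and "finite I" and "\<And>i. i \<in> I \<Longrightarrow> v i \<in> K"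
  shows "(\<Oplus>\<^bsub>M\<^esub>i\<in>I. v i) \<in> K"
proof -
  note K = submoduleE[OF assms(1)]
  show ?thesis using assms(2,3)
  proof (induction I rule: finite_induct)
    case (insert i I)
    then have "(\<Oplus>\<^bsub>M\<^esub>j\<in>insert i I. v j) = v i \<oplus>\<^bsub>M\<^esub> (\<Oplus>\<^bsub>M\<^esub>j\<in>I. v j)"
      using K(1) by (intro M.finsum_insert) auto
    then show ?case using insert K(5) by simp
  qed (simp add: submodule_zero_closed[OF assms(1)])
qed

text \<open>\<open>b j\<close> is the vector whose coordinates are the Kronecker delta; the
  expansion of x holds because both sides have the same coordinates.\<close>

lemma coordinates_basis:
  assumes F: "coordinates R k F p"
  obtains b where "\<And>i. i < k \<Longrightarrow> b i \<in> carrier F"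
    and "\<And>x. x \<in> carrier F \<Longrightarrow> x = (\<Oplus>\<^bsub>F\<^esub>i\<in>{..<k}. p i x \<odot>\<^bsub>F\<^esub> b i)"
    and "\<And>i j. i < k \<Longrightarrow> j < k \<Longrightarrow> p i (b j) = (if i = j then \<one>\<^bsub>R\<^esub> else \<zero>\<^bsub>R\<^esub>)"
proof -
  interpret F: module R F by (rule coordinates_module[OF F])
  interpret self: module R "self_module R" by (rule F.module_self_module)
  note p = coordinates_form[OF F] and pc = coordinates_closed[OF F]
  \<comment> \<open>For j \<ge> k all prescribed coordinates are zero, so \<open>b\<close> can be
    chosen on all of \<open>nat\<close> without a bound on j.\<close>
  have "\<exists>x. x \<in> carrier F \<and> (\<forall>i<k. p i x = (if i = j then \<one>\<^bsub>R\<^esub> else \<zero>\<^bsub>R\<^esub>))" for j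
    by (rule ex1_implies_ex, rule coordinates_ex1[OF F]) simp
  then obtain b where b: "\<And>j. b j \<in> carrier F"
    "\<And>i j. i < k \<Longrightarrow> p i (b j) = (if i = j then \<one>\<^bsub>R\<^esub> else \<zero>\<^bsub>R\<^esub>)" by metis
  have "x = (\<Oplus>\<^bsub>F\<^esub>i\<in>{..<k}. p i x \<odot>\<^bsub>F\<^esub> b i)" if x: "x \<in> carrier F" for x
  proof (rule coordinates_eqI[OF F x])
    show "(\<Oplus>\<^bsub>F\<^esub>i\<in>{..<k}. p i x \<odot>\<^bsub>F\<^esub> b i) \<in> carrier F"
      using x by (intro F.finsum_closed) (auto simp: pc b)
    fix i assume i: "i < k"
    have "p i (\<Oplus>\<^bsub>F\<^esub>j\<in>{..<k}. p j x \<odot>\<^bsub>F\<^esub> b j) = (\<Oplus>\<^bsub>self_module R\<^esub>j\<in>{..<k}. p i (p j x \<odot>\<^bsub>F\<^esub> b j))"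
      using x i
      by (intro lin_map_finsum[OF F.module_axioms self.module_axioms _ p]) (auto simp: pc b)
    also have "\<dots> = (\<Oplus>\<^bsub>self_module R\<^esub>j\<in>{..<k}. if i = j then p j x else \<zero>\<^bsub>self_module R\<^esub>)"
      using x i by (intro self.finsum_cong') (auto simp: lin_map_smult[OF p] pc b)
    also have "\<dots> = p i x" using x i
      by (intro self.finsum_singleton) (auto simp: pc)
    finally show "p i x = p i (\<Oplus>\<^bsub>F\<^esub>j\<in>{..<k}. p j x \<odot>\<^bsub>F\<^esub> b j)" by simp
  qed
  with b that show ?thesis by blast
qed

text \<open>The coproduct property of R^k, given by the map x |-> \<Sum> p i x \<cdot> v i.\<close>

lemma coordinates_coproduct:
  assumes F: "coordinates R k F p" and N: "module R N"
    and b: "\<And>i. i < k \<Longrightarrow> b i \<in> carrier F"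
      "\<And>i j. i < k \<Longrightarrow> j < k \<Longrightarrow> p i (b j) = (if i = j then \<one>\<^bsub>R\<^esub> else \<zero>\<^bsub>R\<^esub>)"
    and v: "\<And>i. i < k \<Longrightarrow> v i \<in> carrier N"
  obtains h where "h \<in> lin_map R F N" and "\<And>i. i < k \<Longrightarrow> h (b i) = v i"
proof -
  interpret F: module R F by (rule coordinates_module[OF F])
  interpret N: module R N by fact
  note p = coordinates_form[OF F]
  let ?h = "\<lambda>x. \<Oplus>\<^bsub>N\<^esub>i\<in>{..<k}. p i x \<odot>\<^bsub>N\<^esub> v i"
  have "?h \<in> lin_map R F N"
    by (intro lin_map_sum[OF F.module_axioms N]) (auto simp: p v)
  moreover have "?h (b j) = v j" if j: "j < k" for j
  proof -
    have "?h (b j) = (\<Oplus>\<^bsub>N\<^esub>i\<in>{..<k}. if j = i then v i else \<zero>\<^bsub>N\<^esub>)"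
      using j by (intro N.finsum_cong') (auto simp: b v)
    also have "\<dots> = v j" using j by (intro N.finsum_singleton) (auto simp: v)
    finally show ?thesis .
  qed
  ultimately show ?thesis using that by blast
qed

section \<open>R^k is finitely generated and projective\<close>

lemma fin_gen_coordinates:
  assumes F: "coordinates R k F p"
  shows "fin_gen R F"
proof -
  interpret F: module R F by (rule coordinates_module[OF F])
  note pc = coordinates_closed[OF F]
  obtain b where b: "\<And>i. i < k \<Longrightarrow> b i \<in> carrier F"
    "\<And>x. x \<in> carrier F \<Longrightarrow> x = (\<Oplus>\<^bsub>F\<^esub>i\<in>{..<k}. p i x \<odot>\<^bsub>F\<^esub> b i)"
    by (rule coordinates_basis[OF F]) (rule that)
  have "N = carrier F" if N: "submodule N R F" "b ` {..<k} \<subseteq> N" for N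
  proof -
    have "x \<in> N" if "x \<in> carrier F" for x
    proof -
      have "(\<Oplus>\<^bsub>F\<^esub>i\<in>{..<k}. p i x \<odot>\<^bsub>F\<^esub> b i) \<in> N"
        using N(2) that by (intro F.submodule_finsum_closed[OF N(1)])
          (auto intro!: F.submoduleE(4)[OF N(1)] simp: pc)
      then show ?thesis using b(2)[OF that] by simp
    qed
    then show ?thesis using F.submoduleE(1)[OF N(1)] by blast
  qed
  then show ?thesis unfolding fin_gen_def
    by (intro conjI F.module_axioms exI[of _ "b ` {..<k}"]) (auto simp: b(1))
qed

text \<open>Preimages under \<open>f\<close> of the vectors \<open>g (b i)\<close> define the lift
  on the basis. The elements where the lifted map agrees with \<open>g\<close> form a submodule
  containing the basis.\<close>

lemma projective_coordinates:
  fixes F :: "('a, 'm) module"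
  assumes F: "coordinates R k F p"
  shows "projective R F"
  unfolding projective_def mod_hom_eq_lin_map
proof (intro conjI allI ballI impI; (elim conjE)?)
  interpret F: module R F by (rule coordinates_module[OF F])
  show "module R F" by (rule F.module_axioms)
  note pc = coordinates_closed[OF F]
  fix A B :: "('a, 'm) module" and f g
  assume f: "f \<in> lin_map R A B" and g: "g \<in> lin_map R F B"
    and A: "module R A" and B: "module R B" and surj: "f ` carrier A = carrier B"
  obtain b where b: "\<And>i. i < k \<Longrightarrow> b i \<in> carrier F"
    "\<And>x. x \<in> carrier F \<Longrightarrow> x = (\<Oplus>\<^bsub>F\<^esub>i\<in>{..<k}. p i x \<odot>\<^bsub>F\<^esub> b i)"
    "\<And>i j. i < k \<Longrightarrow> j < k \<Longrightarrow> p i (b j) = (if i = j then \<one>\<^bsub>R\<^esub> else \<zero>\<^bsub>R\<^esub>)"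
    by (rule coordinates_basis[OF F]) (rule that)
  have "\<exists>a\<in>carrier A. f a = g (b i)" if "i < k" for i
    using lin_map_closed[OF g b(1)[OF that]] surj by (metis imageE)
  then obtain a where a: "\<And>i. i < k \<Longrightarrow> a i \<in> carrier A" "\<And>i. i < k \<Longrightarrow> f (a i) = g (b i)"
    by metis
  obtain h where h: "h \<in> lin_map R F A" "\<And>i. i < k \<Longrightarrow> h (b i) = a i"
    by (rule coordinates_coproduct[OF F A, of b a]) (rule b a that | assumption)+
  have "f (h x) = g x" if x: "x \<in> carrier F" for x
  proof -
    let ?E = "{x \<in> carrier F. f (h x) = g x}"
    have E: "submodule ?E R F"
      by (rule submodule_equalizer[OF F.module_axioms B lin_map_compose[OF h(1) f] g])
    have "(\<Oplus>\<^bsub>F\<^esub>i\<in>{..<k}. p i x \<odot>\<^bsub>F\<^esub> b i) \<in> ?E"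
    proof (rule F.submodule_finsum_closed[OF E])
      fix i assume "i \<in> {..<k}"
      then show "p i x \<odot>\<^bsub>F\<^esub> b i \<in> ?E"
        using x by (intro F.submoduleE(4)[OF E] pc) (auto simp: a b h)
    qed simp
    then show ?thesis using b(2)[OF x] by simp
  qed
  with h(1) show "\<exists>h\<in>lin_map R F A. \<forall>x\<in>carrier F. f (h x) = g x" by blast
qed

section \<open>Room for R^k in the universe\<close>

text \<open>Transport of structure along an encoding of tuples. A tuple is a function on
  \<open>nat\<close> of which only the entries below k count, so \<open>e\<close> has to identify
  exactly the functions that agree there.\<close>

lemma (in cring) coordinates_of_encoding:
  fixes e :: "(nat \<Rightarrow> 'a) \<Rightarrow> 'm"
  assumes e: "\<And>c d. \<lbrakk>c \<in> {..<k} \<rightarrow> carrier R; d \<in> {..<k} \<rightarrow> carrier R\<rbrakk> \<Longrightarrow>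
    e c = e d \<longleftrightarrow> (\<forall>i<k. c i = d i)"
  shows "\<exists>(F :: ('a, 'm) module) p. coordinates R k F p"
proof -
  define C where "C = {..<k} \<rightarrow> carrier R"
  \<comment> \<open>Decoding: the preimage picked by \<open>SOME\<close> is arbitrary beyond k, but
    its entries below k are determined by x.\<close>
  define p where "p = (\<lambda>i x. (SOME c. c \<in> C \<and> e c = x) i)"
  define F :: "('a, 'm) module" where
    "F = \<lparr>carrier = e ` C, mult = undefined, one = undefined, zero = e (\<lambda>_. \<zero>),
      add = (\<lambda>x y. e (\<lambda>i. p i x \<oplus> p i y)), smult = (\<lambda>r x. e (\<lambda>i. r \<otimes> p i x))\<rparr>"
  have F_simps: "carrier F = e ` C" "\<zero>\<^bsub>F\<^esub> = e (\<lambda>_. \<zero>)"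
    "x \<oplus>\<^bsub>F\<^esub> y = e (\<lambda>i. p i x \<oplus> p i y)" "r \<odot>\<^bsub>F\<^esub> x = e (\<lambda>i. r \<otimes> p i x)" for r x y
    by (simp_all add: F_def)
  have p_e: "p i (e c) = c i" if "c \<in> C" "i < k" for c i
  proof -
    have "(SOME d. d \<in> C \<and> e d = e c) \<in> C \<and> e (SOME d. d \<in> C \<and> e d = e c) = e c"
      by (rule someI[of _ c]) (simp add: that(1))
    then show ?thesis using e[of _ c] that unfolding C_def p_def by blast
  qed
  have C: "c \<in> C \<longleftrightarrow> (\<forall>i<k. c i \<in> carrier R)" for c by (auto simp: C_def)
  have pc: "p i x \<in> carrier R" if "x \<in> carrier F" "i < k" for i x
    using that p_e C by (auto simp: F_simps)
  have eqI: "x = y" if "x \<in> carrier F" "y \<in> carrier F" "\<And>i. i < k \<Longrightarrow> p i x = p i y" for x y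
    using that p_e e unfolding F_simps C_def by (smt (verit) imageE)
  have ec: "e c \<in> carrier F" if "\<And>i. i < k \<Longrightarrow> c i \<in> carrier R" for c
    using that by (auto simp: F_simps C)
  have zc: "\<zero>\<^bsub>F\<^esub> \<in> carrier F" by (simp add: F_simps C)
  have ac: "x \<oplus>\<^bsub>F\<^esub> y \<in> carrier F" if "x \<in> carrier F" "y \<in> carrier F" for x y
    unfolding F_simps(3) using that by (intro ec) (simp add: pc)
  have sc: "r \<odot>\<^bsub>F\<^esub> x \<in> carrier F" if "r \<in> carrier R" "x \<in> carrier F" for r x
    unfolding F_simps(4) using that by (intro ec) (simp add: pc)
  have p0: "p i \<zero>\<^bsub>F\<^esub> = \<zero>" if "i < k" for i
    using that by (simp add: F_simps p_e C)
  have pa: "p i (x \<oplus>\<^bsub>F\<^esub> y) = p i x \<oplus> p i y" if "i < k" "x \<in> carrier F" "y \<in> carrier F" for i x y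
    unfolding F_simps(3) using that by (simp add: p_e C pc)
  have ps: "p i (r \<odot>\<^bsub>F\<^esub> x) = r \<otimes> p i x" if "i < k" "r \<in> carrier R" "x \<in> carrier F" for i r x
    unfolding F_simps(4) using that by (simp add: p_e C pc)
  \<comment> \<open>By \<open>eqI\<close> every equation to be checked in \<open>F\<close> reduces
    to the same equation in R for each coordinate; this also serves the module axioms below.\<close>
  have "abelian_group F"
  proof (rule abelian_groupI)
    fix x assume x: "x \<in> carrier F"
    have n: "e (\<lambda>i. \<ominus> p i x) \<in> carrier F" using x by (intro ec) (simp add: pc)
    have pn: "p i (e (\<lambda>i. \<ominus> p i x)) = \<ominus> p i x" if "i < k" for i
      using that x by (simp add: p_e C pc)
    have "e (\<lambda>i. \<ominus> p i x) \<oplus>\<^bsub>F\<^esub> x = \<zero>\<^bsub>F\<^esub>"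
      by (rule eqI) (simp_all add: x n zc ac pa p0 pn pc l_neg)
    with n show "\<exists>y\<in>carrier F. y \<oplus>\<^bsub>F\<^esub> x = \<zero>\<^bsub>F\<^esub>" by blast
  qed (rule eqI; simp add: zc ac pa p0 pc a_ac | simp add: zc ac)+
  then have M: "module R F"
    by (intro moduleI is_cring)
      (rule eqI; simp add: ac sc pa ps pc l_distr r_distr m_assoc | simp add: sc)+
  have "\<exists>!x. x \<in> carrier F \<and> (\<forall>i<k. p i x = c i)" if "c \<in> {..<k} \<rightarrow> carrier R" for c
  proof (rule ex1I)
    show "e c \<in> carrier F \<and> (\<forall>i<k. p i (e c) = c i)" using that by (simp add: F_simps p_e C_def)
    then show "x = e c" if "x \<in> carrier F \<and> (\<forall>i<k. p i x = c i)" for x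
      using that by (intro eqI) auto
  qed
  then have "coordinates R k F p" unfolding coordinates_def
    by (intro conjI allI impI ballI M) (auto intro!: lin_mapI simp: pc pa ps)
  then show ?thesis by blast
qed

text \<open>An infinite type admits an injection of pairs into itself. Iterating it packs k ring
  elements, embedded by \<iota>, into a single element of \<open>'m\<close>.\<close>

lemma (in cring) exists_coordinates:
  assumes "infinite (UNIV :: 'm set)" and \<iota>: "inj_on (\<iota> :: 'a \<Rightarrow> 'm) (carrier R)"
  shows "\<exists>(F :: ('a, 'm) module) p. coordinates R k F p"
proof -
  obtain pr :: "'m \<times> 'm \<Rightarrow> 'm" where pr: "inj pr"
    using card_of_Times_same_infinite[OF assms(1)]
      card_of_ordIso[of "UNIV \<times> UNIV :: ('m \<times> 'm) set" "UNIV :: 'm set"]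
    by (auto simp: bij_betw_def)
  \<comment> \<open>The base value \<open>undefined\<close> is the code of the only tuple of length
    0.\<close>
  define e where "e = rec_nat (\<lambda>_. undefined) (\<lambda>n f c. pr (\<iota> (c n), f c))"
  have e_Suc: "e (Suc n) c = pr (\<iota> (c n), e n c)" for n c by (simp add: e_def)
  show ?thesis
  proof (rule coordinates_of_encoding)
    fix c d assume "c \<in> {..<k} \<rightarrow> carrier R" "d \<in> {..<k} \<rightarrow> carrier R"
    then show "e k c = e k d \<longleftrightarrow> (\<forall>i<k. c i = d i)"
    proof (induction k)
      case (Suc k)
      have cd: "c k \<in> carrier R" "d k \<in> carrier R" using Suc.prems by (simp_all add: Pi_iff)
      have IH: "e k c = e k d \<longleftrightarrow> (\<forall>i<k. c i = d i)"
        by (rule Suc.IH) (use Suc.prems in \<open>simp_all add: Pi_iff\<close>)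
      have "e (Suc k) c = e (Suc k) d \<longleftrightarrow> c k = d k \<and> (\<forall>i<k. c i = d i)"
        using inj_onD[OF \<iota> _ cd] by (auto simp: e_Suc inj_eq[OF pr] IH)
      then show ?case by (auto simp: less_Suc_eq)
    qed (simp add: e_def)
  qed
qed

lemma fg_projective_coordinates: "coordinates R k F p \<Longrightarrow> fg_projective R F"
  by (simp add: fg_projective_def fin_gen_coordinates projective_coordinates)

text \<open>Sending the basis of some R^k to generators of P gives a surjection, and projectivity
  lifts the identity of P through it. Test modules of \<open>projective\<close> have elements in
  \<open>'m\<close>, so the copy of R^k must lie there.\<close>

lemma fg_projective_retract:
  fixes P :: "('a, 'm) module"
  assumes P: "fg_projective R P"
    and ex: "\<And>k. \<exists>(F :: ('a, 'm) module) p. coordinates R k F p"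
  obtains k and F :: "('a, 'm) module" and p s \<pi> where "coordinates R k F p" "s \<in> lin_map R P F"
    "\<pi> \<in> lin_map R F P" "\<And>x. x \<in> carrier P \<Longrightarrow> \<pi> (s x) = x"
proof -
  interpret P: module R P using P by (simp add: fg_projective_def fin_gen_def)
  obtain S where S: "finite S" "S \<subseteq> carrier P"
    "\<And>N. submodule N R P \<Longrightarrow> S \<subseteq> N \<Longrightarrow> N = carrier P"
    using P unfolding fg_projective_def fin_gen_def by blast
  obtain v :: "nat \<Rightarrow> 'm" and k where v: "S = v ` {..<k}"
    using finite_imp_nat_seg_image_inj_on[OF S(1)] by (auto simp: lessThan_def)
  obtain F :: "('a, 'm) module" and p where F: "coordinates R k F p" using ex by blast
  obtain b where b: "\<And>i. i < k \<Longrightarrow> b i \<in> carrier F"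
    "\<And>i j. i < k \<Longrightarrow> j < k \<Longrightarrow> p i (b j) = (if i = j then \<one>\<^bsub>R\<^esub> else \<zero>\<^bsub>R\<^esub>)"
    by (rule coordinates_basis[OF F]) (rule that)
  obtain \<pi> where \<pi>: "\<pi> \<in> lin_map R F P" "\<And>i. i < k \<Longrightarrow> \<pi> (b i) = v i"
    using coordinates_coproduct[OF F P.module_axioms b] S(2) v by (metis image_eqI lessThan_iff subsetD)
  interpret F: module R F by (rule coordinates_module[OF F])
  have "\<pi> ` carrier F = carrier P"
  proof (rule S(3))
    show "submodule (\<pi> ` carrier F) R P"
      using mod_hom_image_submodule[OF F.module_axioms P.module_axioms _ F.carrier_is_submodule] \<pi>(1)
      by (simp add: mod_hom_eq_lin_map)
    show "S \<subseteq> \<pi> ` carrier F" using \<pi>(2) b(1) unfolding v by force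
  qed
  moreover have "projective R P" using P by (simp add: fg_projective_def)
  ultimately obtain s where "s \<in> lin_map R P F" "\<forall>x\<in>carrier P. \<pi> (s x) = x"
    using lin_map_id[of R P] \<pi>(1) F.module_axioms P.module_axioms
    unfolding projective_def mod_hom_eq_lin_map by metis
  then show ?thesis using that F \<pi>(1) by blast
qed

section \<open>Noetherian rings: submodules of R^S\<close>

text \<open>A submodule of R^S given by its closure properties; negatives are multiples by -1. The
  functions are total and arbitrary outside S, so generation is later expressed by agreement on a
  set and not by equality of functions.\<close>

definition function_module :: "('a, 'b) ring_scheme \<Rightarrow> 'm set \<Rightarrow> ('m \<Rightarrow> 'a) set \<Rightarrow> bool" where
  "function_module R S H \<longleftrightarrow> H \<subseteq> S \<rightarrow> carrier R \<and> (\<lambda>_. \<zero>\<^bsub>R\<^esub>) \<in> H \<and>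
     (\<forall>f\<in>H. \<forall>g\<in>H. (\<lambda>x. f x \<oplus>\<^bsub>R\<^esub> g x) \<in> H) \<and> (\<forall>r\<in>carrier R. \<forall>f\<in>H. (\<lambda>x. r \<otimes>\<^bsub>R\<^esub> f x) \<in> H)"

text \<open>The image of H under evaluation at m. Over a Noetherian ring it has finitely many
  generators, which drives the induction on the number of coordinates.\<close>

lemma (in cring) function_module_values_ideal:
  assumes H: "function_module R S H" and m: "m \<in> S"
  shows "ideal {f m | f. f \<in> H} R"
proof (rule idealI[OF ring_axioms])
  have c: "f m \<in> carrier R" if "f \<in> H" for f using H m that by (auto simp: function_module_def)
  have s: "r \<otimes> f m \<in> {f m | f. f \<in> H}" if "f \<in> H" "r \<in> carrier R" for f r
    using H that by (auto simp: function_module_def intro!: exI[of _ "\<lambda>x. r \<otimes> f x"])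
  show "subgroup {f m | f. f \<in> H} (add_monoid R)"
  proof (rule add.subgroupI)
    show "{f m |f. f \<in> H} \<subseteq> carrier R" using c by auto
    show "{f m |f. f \<in> H} \<noteq> {}" using H by (auto simp: function_module_def)
    show "\<ominus> a \<in> {f m |f. f \<in> H}" if "a \<in> {f m |f. f \<in> H}" for a
      using that s[of _ "\<ominus> \<one>"] c by (auto simp: l_minus)
    show "a \<oplus> b \<in> {f m |f. f \<in> H}" if ab: "a \<in> {f m |f. f \<in> H}" "b \<in> {f m |f. f \<in> H}" for a b
    proof -
      obtain f g where "f \<in> H" "g \<in> H" "a = f m" "b = g m" using ab by blast
      then show ?thesis using H
        by (auto simp: function_module_def intro!: exI[of _ "\<lambda>x. f x \<oplus> g x"])
    qed
  qed
  show "x \<otimes> a \<in> {f m |f. f \<in> H}" "a \<otimes> x \<in> {f m |f. f \<in> H}"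
    if "a \<in> {f m |f. f \<in> H}" "x \<in> carrier R" for a x
    using that s c by (auto simp: m_comm)
qed

text \<open>
  A submodule \<open>H\<close> of \<open>R\<^sup>S\<close> is finitely generated for finite \<open>S\<close>.  Finite generation is stated
  through the submodules \<open>V\<close> that contain the generators.
\<close>

lemma function_module_fin_gen:
  fixes R (structure)
  assumes R: "noetherian_ring R" "cring R" and "finite T" and "T \<subseteq> S" and "function_module R S H"
  shows "\<exists>\<Phi>. finite \<Phi> \<and> \<Phi> \<subseteq> H \<and> (\<forall>V. function_module R S V \<and> \<Phi> \<subseteq> V \<longrightarrow>
    (\<forall>f\<in>H. \<exists>g\<in>V \<inter> H. \<forall>x\<in>T. g x = f x))"
  using assms(3-5)
proof (induction T arbitrary: H rule: finite_induct)
  case empty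
  then show ?case by (intro exI[of _ "{}"]) (auto simp: function_module_def)
next
  case (insert m T)
  interpret noetherian_ring R by fact
  interpret cring R by fact
  note H = \<open>function_module R S H\<close>
  have m: "m \<in> S" and T: "T \<subseteq> S" using insert.prems by auto
  have Hc: "f x \<in> carrier R" if "f \<in> H" "x \<in> S" for f x
    using H that by (auto simp: function_module_def)
  obtain A where A: "finite A" "A \<subseteq> carrier R" "{f m | f. f \<in> H} = Idl A"
    using finetely_gen[OF function_module_values_ideal[OF H m]] by blast
  have "\<forall>a\<in>A. \<exists>f. f \<in> H \<and> f m = a"
  proof
    fix a assume "a \<in> A"
    then have "a \<in> {f m | f. f \<in> H}" using genideal_self[OF A(2)] A(3) by auto
    then show "\<exists>f. f \<in> H \<and> f m = a" by auto
  qed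
  from bchoice[OF this] obtain \<phi> where \<phi>: "\<forall>a\<in>A. \<phi> a \<in> H \<and> \<phi> a m = a" ..
  \<comment> \<open>H is an extension of the ideal of its values at m by the functions vanishing at
    m. Generators of the latter come from the induction hypothesis, those of the ideal are lifted by
    \<phi>.\<close>
  have "function_module R S {f \<in> H. f m = \<zero>}"
    using H m by (auto simp: function_module_def)
  from insert.IH[OF T this] obtain \<Phi> where \<Phi>: "finite \<Phi>" "\<Phi> \<subseteq> {f \<in> H. f m = \<zero>}"
    "\<forall>V. function_module R S V \<and> \<Phi> \<subseteq> V \<longrightarrow> (\<forall>f\<in>{f \<in> H. f m = \<zero>}.
      \<exists>g\<in>V \<inter> {f \<in> H. f m = \<zero>}. \<forall>x\<in>T. g x = f x)"
    by (elim exE conjE)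
  show ?case
  proof (intro exI[of _ "\<phi> ` A \<union> \<Phi>"] conjI allI impI ballI)
    show "finite (\<phi> ` A \<union> \<Phi>)" "\<phi> ` A \<union> \<Phi> \<subseteq> H" using A(1) \<Phi>(1,2) \<phi> by auto
    fix V f assume "function_module R S V \<and> \<phi> ` A \<union> \<Phi> \<subseteq> V" and f: "f \<in> H"
    then have V: "function_module R S V" "\<phi> ` A \<subseteq> V" "\<Phi> \<subseteq> V" by auto
    \<comment> \<open>The function g matching f at m must lie in H as well as in V, because the
      induction hypothesis is applied to f - g. Hence the ideal of values is taken for V \<inter>
      H.\<close>
    have VH: "function_module R S (V \<inter> H)" using V(1) H by (auto simp: function_module_def)
    have "Idl A \<subseteq> {f m | f. f \<in> V \<inter> H}"
    proof (intro genideal_minimal function_module_values_ideal[OF VH m] subsetI)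
      fix a assume "a \<in> A"
      then have "\<phi> a \<in> V \<inter> H" "a = \<phi> a m" using \<phi> V(2) by auto
      then show "a \<in> {f m | f. f \<in> V \<inter> H}" by blast
    qed
    then have "f m \<in> {f m | f. f \<in> V \<inter> H}" using A(3) f by auto
    then obtain g where g: "g \<in> V" "g \<in> H" "g m = f m" by auto
    \<comment> \<open>The difference f - g, with the negative written as a scalar multiple to fit
      \<open>function_module\<close>.\<close>
    have f': "(\<lambda>x. f x \<oplus> \<ominus> \<one> \<otimes> g x) \<in> H"
      using H f g(2) by (auto simp: function_module_def)
    have "f m \<oplus> \<ominus> \<one> \<otimes> g m = \<zero>"
      using Hc[OF f m] g(3) by (simp add: l_minus r_neg)
    with f' have "(\<lambda>x. f x \<oplus> \<ominus> \<one> \<otimes> g x) \<in> {f \<in> H. f m = \<zero>}" by blast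
    from \<Phi>(3)[THEN spec, THEN mp, OF conjI[OF V(1,3)], THEN bspec, OF this]
    obtain h where h: "h \<in> V" "h \<in> H" "h m = \<zero>"
      "\<And>x. x \<in> T \<Longrightarrow> h x = f x \<oplus> \<ominus> \<one> \<otimes> g x" by blast
    have "(\<lambda>x. h x \<oplus> g x) \<in> V \<inter> H"
      using VH h(1,2) g(1,2) by (simp add: function_module_def)
    moreover have "h x \<oplus> g x = f x" if "x \<in> insert m T" for x
    proof -
      have "x \<in> S" using that m T by auto
      then show ?thesis using that h(3,4) g(3) Hc[OF f] Hc[OF g(2)]
        by (auto simp: l_minus a_assoc l_neg)
    qed
    ultimately show "\<exists>g\<in>V \<inter> H. \<forall>x\<in>insert m T. g x = f x"
      by (intro bexI[of _ "\<lambda>x. h x \<oplus> g x"] ballI)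
  qed
qed

section \<open>Over a domain, forms detect non-torsion elements\<close>

text \<open>On N + R m the form is n + s m |-> r \<phi>(n) + s t, and \<open>rel\<close> says that
  it respects every relation. The factor r is there because \<phi> itself may have no
  extension.\<close>

lemma linear_form_extend:
  fixes R (structure) and M :: "('a, 'm) module"
  assumes M: "module R M" and N: "submodule N R M" and \<phi>: "\<phi> \<in> linear_forms R (M\<lparr>carrier := N\<rparr>)"
    and m: "m \<in> carrier M" and r: "r \<in> carrier R" and t: "t \<in> carrier R"
    and rel: "\<And>n s. \<lbrakk>n \<in> N; s \<in> carrier R; n \<oplus>\<^bsub>M\<^esub> s \<odot>\<^bsub>M\<^esub> m = \<zero>\<^bsub>M\<^esub>\<rbrakk> \<Longrightarrow> r \<otimes> \<phi> n \<oplus> s \<otimes> t = \<zero>"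
  obtains N' \<psi> where "submodule N' R M" "N \<subseteq> N'" "m \<in> N'"
    "\<psi> \<in> linear_forms R (M\<lparr>carrier := N'\<rparr>)" "\<And>n. n \<in> N \<Longrightarrow> \<psi> n = r \<otimes> \<phi> n" "\<psi> m = t"
proof -
  interpret module R M by fact
  note N_closed = submoduleE[OF N] and N0 = submodule_zero_closed[OF N]
  have NM: "n \<in> carrier M" if "n \<in> N" for n using N_closed(1) that by blast
  have \<phi>c: "\<phi> n \<in> carrier R" if "n \<in> N" for n using lin_map_closed[OF \<phi>] that by simp
  have \<phi>a: "\<phi> (a \<oplus>\<^bsub>M\<^esub> b) = \<phi> a \<oplus> \<phi> b" if "a \<in> N" "b \<in> N" for a b
    using lin_map_add[OF \<phi>] that by simp
  have \<phi>s: "\<phi> (c \<odot>\<^bsub>M\<^esub> a) = c \<otimes> \<phi> a" if "c \<in> carrier R" "a \<in> N" for c a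
    using lin_map_smult[OF \<phi>] that by simp
  have \<phi>0: "\<phi> \<zero>\<^bsub>M\<^esub> = \<zero>" using \<phi>s[OF R.zero_closed N0] \<phi>c[OF N0] by simp
  have \<phi>n: "\<phi> (\<ominus>\<^bsub>M\<^esub> a) = \<ominus> \<phi> a" if "a \<in> N" for a
    using \<phi>s[of "\<ominus> \<one>" a] smult_l_minus[of \<one> a] NM[OF that] \<phi>c[OF that] that
    by (simp add: R.l_minus)
  \<comment> \<open>The difference of two representations of one element is a relation, which
    \<open>rel\<close> sends to zero.\<close>
  have wd: "r \<otimes> \<phi> n \<oplus> s \<otimes> t = r \<otimes> \<phi> n' \<oplus> s' \<otimes> t"
    if n: "n \<in> N" "n' \<in> N" and s: "s \<in> carrier R" "s' \<in> carrier R"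
      and eq: "n \<oplus>\<^bsub>M\<^esub> s \<odot>\<^bsub>M\<^esub> m = n' \<oplus>\<^bsub>M\<^esub> s' \<odot>\<^bsub>M\<^esub> m" for n n' s s'
  proof -
    have "(n \<oplus>\<^bsub>M\<^esub> \<ominus>\<^bsub>M\<^esub> n') \<oplus>\<^bsub>M\<^esub> (s \<oplus> \<ominus> s') \<odot>\<^bsub>M\<^esub> m
        = (n \<oplus>\<^bsub>M\<^esub> s \<odot>\<^bsub>M\<^esub> m) \<oplus>\<^bsub>M\<^esub> \<ominus>\<^bsub>M\<^esub> (n' \<oplus>\<^bsub>M\<^esub> s' \<odot>\<^bsub>M\<^esub> m)"
      using n s m by (simp add: NM smult_l_distr smult_l_minus M.minus_add M.a_ac)
    also have "\<dots> = \<zero>\<^bsub>M\<^esub>" using n s m by (simp add: eq NM M.r_neg)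
    finally have "r \<otimes> \<phi> (n \<oplus>\<^bsub>M\<^esub> \<ominus>\<^bsub>M\<^esub> n') \<oplus> (s \<oplus> \<ominus> s') \<otimes> t = \<zero>"
      using n s N_closed by (intro rel) auto
    moreover have "r \<otimes> \<phi> (n \<oplus>\<^bsub>M\<^esub> \<ominus>\<^bsub>M\<^esub> n') \<oplus> (s \<oplus> \<ominus> s') \<otimes> t
        = (r \<otimes> \<phi> n \<oplus> s \<otimes> t) \<ominus> (r \<otimes> \<phi> n' \<oplus> s' \<otimes> t)"
      using n s r t N_closed(3)
      by (simp add: \<phi>a \<phi>n \<phi>c R.r_distr R.l_distr R.r_minus R.l_minus R.minus_add R.a_ac R.minus_eq)
    ultimately show ?thesis using n s r t \<phi>c by simp
  qed
  define N' where "N' = {n \<oplus>\<^bsub>M\<^esub> s \<odot>\<^bsub>M\<^esub> m | n s. n \<in> N \<and> s \<in> carrier R}"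
  define \<psi> where "\<psi> y = (SOME v. \<exists>n\<in>N. \<exists>s\<in>carrier R. y = n \<oplus>\<^bsub>M\<^esub> s \<odot>\<^bsub>M\<^esub> m \<and> v = r \<otimes> \<phi> n \<oplus> s \<otimes> t)" for y
  have \<psi>: "\<psi> (n \<oplus>\<^bsub>M\<^esub> s \<odot>\<^bsub>M\<^esub> m) = r \<otimes> \<phi> n \<oplus> s \<otimes> t" if "n \<in> N" "s \<in> carrier R" for n s
    unfolding \<psi>_def
  proof (rule some_equality)
    show "\<exists>n'\<in>N. \<exists>s'\<in>carrier R. n \<oplus>\<^bsub>M\<^esub> s \<odot>\<^bsub>M\<^esub> m = n' \<oplus>\<^bsub>M\<^esub> s' \<odot>\<^bsub>M\<^esub> m \<and>
        r \<otimes> \<phi> n \<oplus> s \<otimes> t = r \<otimes> \<phi> n' \<oplus> s' \<otimes> t"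
      using that by (intro bexI[of _ n] bexI[of _ s]) auto
  qed (elim bexE conjE, hypsubst, rule wd[OF _ that(1) _ that(2)], auto)
  have add: "(n \<oplus>\<^bsub>M\<^esub> s \<odot>\<^bsub>M\<^esub> m) \<oplus>\<^bsub>M\<^esub> (n' \<oplus>\<^bsub>M\<^esub> s' \<odot>\<^bsub>M\<^esub> m) = (n \<oplus>\<^bsub>M\<^esub> n') \<oplus>\<^bsub>M\<^esub> (s \<oplus> s') \<odot>\<^bsub>M\<^esub> m"
    if "n \<in> N" "n' \<in> N" "s \<in> carrier R" "s' \<in> carrier R" for n n' s s'
    using that m by (simp add: NM smult_l_distr M.a_ac)
  have smult: "c \<odot>\<^bsub>M\<^esub> (n \<oplus>\<^bsub>M\<^esub> s \<odot>\<^bsub>M\<^esub> m) = c \<odot>\<^bsub>M\<^esub> n \<oplus>\<^bsub>M\<^esub> (c \<otimes> s) \<odot>\<^bsub>M\<^esub> m"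
    if "n \<in> N" "c \<in> carrier R" "s \<in> carrier R" for n c s
    using that m by (simp add: NM smult_r_distr smult_assoc1)
  have N'I: "n \<oplus>\<^bsub>M\<^esub> s \<odot>\<^bsub>M\<^esub> m \<in> N'" if "n \<in> N" "s \<in> carrier R" for n s
    using that by (auto simp: N'_def)
  have N'E: "\<exists>n s. y = n \<oplus>\<^bsub>M\<^esub> s \<odot>\<^bsub>M\<^esub> m \<and> n \<in> N \<and> s \<in> carrier R" if "y \<in> N'" for y
    using that by (auto simp: N'_def)
  have n_eq: "n \<oplus>\<^bsub>M\<^esub> \<zero> \<odot>\<^bsub>M\<^esub> m = n" if "n \<in> N" for n using NM[OF that] m by simp
  have m_eq: "\<zero>\<^bsub>M\<^esub> \<oplus>\<^bsub>M\<^esub> \<one> \<odot>\<^bsub>M\<^esub> m = m" using m by simp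
  have NN': "n \<in> N'" if "n \<in> N" for n using N'I[OF that R.zero_closed] n_eq[OF that] by simp
  show ?thesis
  proof
    show "submodule N' R M"
    proof (rule submoduleI')
      show "N' \<subseteq> carrier M" using m by (auto simp: N'_def NM)
      show "\<zero>\<^bsub>M\<^esub> \<in> N'" by (rule NN'[OF N0])
      show "a \<oplus>\<^bsub>M\<^esub> b \<in> N'" if "a \<in> N'" "b \<in> N'" for a b
        using N'E[OF that(1)] N'E[OF that(2)] by (auto simp: add intro!: N'I N_closed(5))
      show "c \<odot>\<^bsub>M\<^esub> a \<in> N'" if "c \<in> carrier R" "a \<in> N'" for c a
        using N'E[OF that(2)] that(1) by (auto simp: smult intro!: N'I N_closed(4))
    qed
    show "N \<subseteq> N'" using NN' by blast
    show "m \<in> N'" using N'I[OF N0 R.one_closed] m_eq by simp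
    show "\<psi> \<in> linear_forms R (M\<lparr>carrier := N'\<rparr>)"
    proof (rule lin_mapI)
      show "\<psi> x \<in> carrier (self_module R)" if "x \<in> carrier (M\<lparr>carrier := N'\<rparr>)" for x
        using N'E[of x] that r t by (auto simp: \<psi> \<phi>c)
      show "\<psi> (x \<oplus>\<^bsub>M\<lparr>carrier := N'\<rparr>\<^esub> y) = \<psi> x \<oplus>\<^bsub>self_module R\<^esub> \<psi> y"
        if "x \<in> carrier (M\<lparr>carrier := N'\<rparr>)" "y \<in> carrier (M\<lparr>carrier := N'\<rparr>)" for x y
      proof -
        obtain n s n' s' where *: "x = n \<oplus>\<^bsub>M\<^esub> s \<odot>\<^bsub>M\<^esub> m" "n \<in> N" "s \<in> carrier R"
          "y = n' \<oplus>\<^bsub>M\<^esub> s' \<odot>\<^bsub>M\<^esub> m" "n' \<in> N" "s' \<in> carrier R"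
          using N'E[of x] N'E[of y] \<open>x \<in> _\<close> \<open>y \<in> _\<close> by auto
        then show ?thesis using r t
          by (simp add: add \<psi> N_closed(5) \<phi>a \<phi>c R.r_distr R.l_distr R.a_ac)
      qed
      show "\<psi> (c \<odot>\<^bsub>M\<lparr>carrier := N'\<rparr>\<^esub> x) = c \<odot>\<^bsub>self_module R\<^esub> \<psi> x"
        if "c \<in> carrier R" "x \<in> carrier (M\<lparr>carrier := N'\<rparr>)" for c x
      proof -
        obtain n s where *: "x = n \<oplus>\<^bsub>M\<^esub> s \<odot>\<^bsub>M\<^esub> m" "n \<in> N" "s \<in> carrier R"
          using N'E[of x] \<open>x \<in> _\<close> by auto
        then show ?thesis using r t \<open>c \<in> _\<close>
          by (simp add: smult \<psi> N_closed(4) \<phi>s \<phi>c R.r_distr R.m_ac)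
      qed
    qed
    show "\<psi> n = r \<otimes> \<phi> n" if "n \<in> N" for n
      using \<psi>[OF that R.zero_closed] n_eq[OF that] \<phi>c[OF that] r t by simp
    show "\<psi> m = t"
      using \<psi>[OF N0 R.one_closed] m_eq \<phi>0 r t by simp
  qed
qed

definition torsion :: "('a, 'b) ring_scheme \<Rightarrow> ('a, 'm) module \<Rightarrow> 'm \<Rightarrow> bool" where
  "torsion R M x \<longleftrightarrow> (\<exists>r\<in>carrier R - {\<zero>\<^bsub>R\<^esub>}. r \<odot>\<^bsub>M\<^esub> x = \<zero>\<^bsub>M\<^esub>)"

text \<open>
  A form is extended one generator at a time.  If a nonzero multiple of the new generator
  already lies in the domain, then the form has to be rescaled to clear the denominator.
\<close>

lemma exists_form_nonzero:
  fixes R (structure)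
  assumes R: "domain R" and fg: "fin_gen R M" and x: "x \<in> carrier M" and nt: "\<not> torsion R M x"
  obtains \<phi> where "\<phi> \<in> linear_forms R M" "\<phi> x \<noteq> \<zero>"
proof -
  interpret domain R by fact
  interpret M: module R M using fg by (simp add: fin_gen_def)
  obtain S where S: "finite S" "S \<subseteq> carrier M"
    "\<And>N. submodule N R M \<Longrightarrow> S \<subseteq> N \<Longrightarrow> N = carrier M"
    using fg unfolding fin_gen_def by blast
  have "\<exists>N \<phi>. submodule N R M \<and> T \<subseteq> N \<and> x \<in> N \<and> \<phi> \<in> linear_forms R (M\<lparr>carrier := N\<rparr>) \<and> \<phi> x \<noteq> \<zero>"
    if "finite T" "T \<subseteq> carrier M" for T
    using that
  proof (induction T rule: finite_induct)
    case empty
    have 0: "submodule {\<zero>\<^bsub>M\<^esub>} R M" by (rule M.submoduleI') auto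
    have "(\<lambda>_. \<zero>) \<in> linear_forms R (M\<lparr>carrier := {\<zero>\<^bsub>M\<^esub>}\<rparr>)" by (rule lin_mapI) auto
    \<comment> \<open>The start is s x |-> s on the multiples of x, obtained from the zero form with
      r = 0 and t = 1. It is well defined because x is not torsion.\<close>
    then obtain N' \<psi> where "submodule N' R M" "x \<in> N'"
      "\<psi> \<in> linear_forms R (M\<lparr>carrier := N'\<rparr>)" "\<psi> x = \<one>"
    proof (rule linear_form_extend[OF M.module_axioms 0 _ x zero_closed one_closed])
      fix n s assume "n \<in> {\<zero>\<^bsub>M\<^esub>}" and s: "s \<in> carrier R" and "n \<oplus>\<^bsub>M\<^esub> s \<odot>\<^bsub>M\<^esub> x = \<zero>\<^bsub>M\<^esub>"
      then have "s \<odot>\<^bsub>M\<^esub> x = \<zero>\<^bsub>M\<^esub>" using x by simp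
      then have "s = \<zero>" using nt s by (auto simp: torsion_def)
      then show "\<zero> \<otimes> \<zero> \<oplus> s \<otimes> \<one> = \<zero>" by simp
    qed
    then show ?case using one_not_zero by (intro exI[of _ N'] exI[of _ \<psi>]) auto
  next
    case (insert m T)
    then obtain N \<phi> where N: "submodule N R M" "T \<subseteq> N" "x \<in> N"
      and \<phi>: "\<phi> \<in> linear_forms R (M\<lparr>carrier := N\<rparr>)" "\<phi> x \<noteq> \<zero>" by auto
    have m: "m \<in> carrier M" using insert.prems by simp
    note N_closed = M.submoduleE[OF N(1)]
    have \<phi>c: "\<phi> n \<in> carrier R" if "n \<in> N" for n using lin_map_closed[OF \<phi>(1)] that by simp
    have \<phi>a: "\<phi> (a \<oplus>\<^bsub>M\<^esub> b) = \<phi> a \<oplus> \<phi> b" if "a \<in> N" "b \<in> N" for a b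
      using lin_map_add[OF \<phi>(1)] that by simp
    have \<phi>s: "\<phi> (c \<odot>\<^bsub>M\<^esub> a) = c \<otimes> \<phi> a" if "c \<in> carrier R" "a \<in> N" for c a
      using lin_map_smult[OF \<phi>(1)] that by simp
    have \<phi>0: "\<phi> \<zero>\<^bsub>M\<^esub> = \<zero>"
      using \<phi>s[OF zero_closed N(3)] \<phi>c[OF N(3)] N(3) N_closed(1) by (simp add: subsetD)
    have "\<exists>r\<in>carrier R - {\<zero>}. \<exists>t\<in>carrier R. \<forall>n\<in>N. \<forall>s\<in>carrier R.
      n \<oplus>\<^bsub>M\<^esub> s \<odot>\<^bsub>M\<^esub> m = \<zero>\<^bsub>M\<^esub> \<longrightarrow> r \<otimes> \<phi> n \<oplus> s \<otimes> t = \<zero>"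
    proof (cases "\<exists>r\<in>carrier R - {\<zero>}. r \<odot>\<^bsub>M\<^esub> m \<in> N")
      \<comment> \<open>If r m lies in N, the form r \<phi> has to take the value t = \<phi>(r m) at
        m. A relation n + s m = 0, multiplied by r, becomes a relation inside N, which \<phi>
        respects.\<close>
      case True
      then obtain r where r: "r \<in> carrier R" "r \<noteq> \<zero>" "r \<odot>\<^bsub>M\<^esub> m \<in> N" by blast
      have "r \<otimes> \<phi> n \<oplus> s \<otimes> \<phi> (r \<odot>\<^bsub>M\<^esub> m) = \<zero>"
        if n: "n \<in> N" and s: "s \<in> carrier R" and eq: "n \<oplus>\<^bsub>M\<^esub> s \<odot>\<^bsub>M\<^esub> m = \<zero>\<^bsub>M\<^esub>" for n s
      proof -
        have "r \<otimes> \<phi> n \<oplus> s \<otimes> \<phi> (r \<odot>\<^bsub>M\<^esub> m) = \<phi> (r \<odot>\<^bsub>M\<^esub> n \<oplus>\<^bsub>M\<^esub> s \<odot>\<^bsub>M\<^esub> (r \<odot>\<^bsub>M\<^esub> m))"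
          using n s r by (simp add: \<phi>a \<phi>s N_closed(4))
        also have "r \<odot>\<^bsub>M\<^esub> n \<oplus>\<^bsub>M\<^esub> s \<odot>\<^bsub>M\<^esub> (r \<odot>\<^bsub>M\<^esub> m) = r \<odot>\<^bsub>M\<^esub> (n \<oplus>\<^bsub>M\<^esub> s \<odot>\<^bsub>M\<^esub> m)"
          using n s r m N_closed(1)
          by (simp add: subsetD M.smult_r_distr M.smult_assoc1[symmetric] m_comm)
        finally show ?thesis using r by (simp add: eq \<phi>0)
      qed
      with r \<phi>c show ?thesis by blast
    next
      \<comment> \<open>Now n + s m = 0 forces s = 0 and n = 0. No rescaling is required and the
        value at m is free; zero is taken.\<close>
      case False
      have "\<one> \<otimes> \<phi> n \<oplus> s \<otimes> \<zero> = \<zero>"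
        if n: "n \<in> N" and s: "s \<in> carrier R" and eq: "n \<oplus>\<^bsub>M\<^esub> s \<odot>\<^bsub>M\<^esub> m = \<zero>\<^bsub>M\<^esub>" for n s
      proof -
        have nM: "n \<in> carrier M" using n N_closed(1) by blast
        have "s \<odot>\<^bsub>M\<^esub> m \<oplus>\<^bsub>M\<^esub> n = \<zero>\<^bsub>M\<^esub>" using eq nM s m by (simp add: M.a_comm)
        then have "s \<odot>\<^bsub>M\<^esub> m = \<ominus>\<^bsub>M\<^esub> n"
          using M.minus_equality[of "s \<odot>\<^bsub>M\<^esub> m" n] nM s m by simp
        then have "s \<odot>\<^bsub>M\<^esub> m \<in> N" using N_closed(3)[OF n] by simp
        then have "s = \<zero>" using False s by blast
        then have "n = \<zero>\<^bsub>M\<^esub>" using eq nM m by simp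
        then show ?thesis using s \<phi>0 by simp
      qed
      then show ?thesis using one_not_zero by (intro bexI[of _ \<one>] bexI[of _ \<zero>]) auto
    qed
    then obtain r t where r: "r \<in> carrier R" "r \<noteq> \<zero>" and t: "t \<in> carrier R"
      and rel: "\<And>n s. n \<in> N \<Longrightarrow> s \<in> carrier R \<Longrightarrow> n \<oplus>\<^bsub>M\<^esub> s \<odot>\<^bsub>M\<^esub> m = \<zero>\<^bsub>M\<^esub> \<Longrightarrow> r \<otimes> \<phi> n \<oplus> s \<otimes> t = \<zero>"
      by (elim bexE) blast
    obtain N' \<psi> where N': "submodule N' R M" "N \<subseteq> N'" "m \<in> N'"
      and \<psi>: "\<psi> \<in> linear_forms R (M\<lparr>carrier := N'\<rparr>)" "\<And>n. n \<in> N \<Longrightarrow> \<psi> n = r \<otimes> \<phi> n"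
      by (rule linear_form_extend[OF M.module_axioms N(1) \<phi>(1) m r(1) t]) (rule rel that | assumption)+
    \<comment> \<open>Rescaling by r \<noteq> 0 cannot kill \<phi>(x), since R has no zero
      divisors.\<close>
    have "\<psi> x \<noteq> \<zero>" using \<psi>(2)[OF N(3)] r \<phi>(2) \<phi>c[OF N(3)] integral by metis
    then show ?case using N' \<psi>(1) N(2,3) by (intro exI[of _ N'] exI[of _ \<psi>]) auto
  qed
  from this[OF S(1,2)] S(3) obtain \<phi> where
    "\<phi> \<in> linear_forms R (M\<lparr>carrier := carrier M\<rparr>)" "\<phi> x \<noteq> \<zero>" by metis
  then show ?thesis using that by simp
qed

section \<open>Preenvelopes and their kernels\<close>

text \<open>The factorization property of a preenvelope, tested on R alone. It is separate from
  \<open>preenvelope\<close> because \<open>self_module R\<close> has its elements in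
  \<open>'a\<close>.\<close>

definition forms_factor :: "('a, 'b) ring_scheme \<Rightarrow> ('a, 'm) module \<Rightarrow> ('a, 'n) module \<Rightarrow> ('m \<Rightarrow> 'n) \<Rightarrow> bool"
  where "forms_factor R M F \<alpha> \<longleftrightarrow>
    (\<forall>f\<in>linear_forms R M. \<exists>h\<in>linear_forms R F. \<forall>x\<in>carrier M. f x = h (\<alpha> x))"

lemma function_module_linear_forms:
  assumes "module R M"
  shows "function_module R (carrier M) (linear_forms R M)"
proof -
  interpret M: module R M by fact
  have "(\<lambda>_. \<zero>\<^bsub>R\<^esub>) \<in> linear_forms R M" by (rule lin_mapI) auto
  moreover have "(\<lambda>x. f x \<oplus>\<^bsub>R\<^esub> g x) \<in> linear_forms R M"
    if f: "f \<in> linear_forms R M" and g: "g \<in> linear_forms R M" for f g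
    using lin_map_closed[OF f] lin_map_closed[OF g]
    by (intro lin_mapI) (auto simp: lin_mapD[OF f] lin_mapD[OF g] M.R.a_ac M.R.r_distr)
  moreover have "(\<lambda>x. r \<otimes>\<^bsub>R\<^esub> f x) \<in> linear_forms R M"
    if f: "f \<in> linear_forms R M" and "r \<in> carrier R" for f r
    using lin_map_closed[OF f] that(2)
    by (intro lin_mapI) (auto simp: lin_mapD[OF f] M.R.m_ac M.R.r_distr)
  ultimately show ?thesis
    by (auto simp: function_module_def lin_map_closed[where N = "self_module R", simplified])
qed

text \<open>A form is determined by its values on a finite generating set S, which places the dual
  of M inside R^S, where the Noetherian property makes it finitely generated.\<close>

lemma exists_forms_factor:
  fixes M :: "('a, 'm) module"
  assumes R: "noetherian_ring R" and fg: "fin_gen R M"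
    and ex: "\<And>k. \<exists>(F :: ('a, 'n) module) p. coordinates R k F p"
  obtains k and F :: "('a, 'n) module" and p \<alpha> where "coordinates R k F p"
    "\<alpha> \<in> lin_map R M F" "forms_factor R M F \<alpha>"
proof -
  interpret M: module R M using fg by (simp add: fin_gen_def)
  interpret self: module R "self_module R" by (rule M.module_self_module)
  obtain S where S: "finite S" "S \<subseteq> carrier M"
    "\<And>N. submodule N R M \<Longrightarrow> S \<subseteq> N \<Longrightarrow> N = carrier M"
    using fg unfolding fin_gen_def by blast
  note H = function_module_linear_forms[OF M.module_axioms]
  obtain \<Phi> where \<Phi>: "finite \<Phi>" "\<Phi> \<subseteq> linear_forms R M"
    "\<forall>V. function_module R (carrier M) V \<and> \<Phi> \<subseteq> V \<longrightarrow>
      (\<forall>f\<in>linear_forms R M. \<exists>g\<in>V \<inter> linear_forms R M. \<forall>x\<in>S. g x = f x)"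
    using function_module_fin_gen[OF R M.is_cring S(1,2) H] by (elim exE conjE)
  obtain \<phi> and k :: nat where \<phi>: "\<Phi> = \<phi> ` {..<k}"
    using finite_imp_nat_seg_image_inj_on[OF \<Phi>(1)] by (auto simp: lessThan_def)
  obtain F :: "('a, 'n) module" and p where F: "coordinates R k F p" using ex by blast
  interpret F: module R F by (rule coordinates_module[OF F])
  obtain \<alpha> where \<alpha>: "\<alpha> \<in> lin_map R M F" "\<And>x i. x \<in> carrier M \<Longrightarrow> i < k \<Longrightarrow> p i (\<alpha> x) = \<phi> i x"
  proof (rule coordinates_product[OF F M.module_axioms, of \<phi>])
    show "\<phi> i \<in> linear_forms R M" if "i < k" for i using \<Phi>(2) \<phi> that by auto
  qed (rule that)
  \<comment> \<open>The forms that factor through \<alpha>. They include the generators \<Phi>,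
    since these are the coordinates of \<alpha>.\<close>
  define V where "V = {f \<in> linear_forms R M. \<exists>h\<in>linear_forms R F. \<forall>x\<in>carrier M. f x = h (\<alpha> x)}"
  have "function_module R (carrier M) V"
    unfolding function_module_def
  proof (intro conjI ballI)
    note HF = function_module_linear_forms[OF F.module_axioms]
    show "V \<subseteq> carrier M \<rightarrow> carrier R" using H by (auto simp: V_def function_module_def)
    show "(\<lambda>_. \<zero>\<^bsub>R\<^esub>) \<in> V"
      using H HF by (auto simp: V_def function_module_def intro!: bexI[of _ "\<lambda>_. \<zero>\<^bsub>R\<^esub>"])
    fix f assume "f \<in> V"
    then obtain h where f: "f \<in> linear_forms R M" and h: "h \<in> linear_forms R F"
      "\<And>x. x \<in> carrier M \<Longrightarrow> f x = h (\<alpha> x)" by (auto simp: V_def)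
    show "(\<lambda>x. r \<otimes>\<^bsub>R\<^esub> f x) \<in> V" if "r \<in> carrier R" for r
      using H HF f h that
      by (auto simp: V_def function_module_def intro!: bexI[of _ "\<lambda>x. r \<otimes>\<^bsub>R\<^esub> h x"])
    fix g assume "g \<in> V"
    then obtain h' where g: "g \<in> linear_forms R M" and h': "h' \<in> linear_forms R F"
      "\<And>x. x \<in> carrier M \<Longrightarrow> g x = h' (\<alpha> x)" by (auto simp: V_def)
    show "(\<lambda>x. f x \<oplus>\<^bsub>R\<^esub> g x) \<in> V"
      using H HF f h g h'
      by (auto simp: V_def function_module_def intro!: bexI[of _ "\<lambda>x. h x \<oplus>\<^bsub>R\<^esub> h' x"])
  qed
  moreover have "\<Phi> \<subseteq> V"
  proof
    fix f assume f: "f \<in> \<Phi>"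
    then obtain i where i: "i < k" "f = \<phi> i" using \<phi> by blast
    have "f \<in> linear_forms R M" using f \<Phi>(2) by blast
    with i \<alpha>(2) coordinates_form[OF F i(1)] show "f \<in> V"
      unfolding V_def by (auto intro!: bexI[of _ "p i"])
  qed
  ultimately have VH: "\<forall>f\<in>linear_forms R M. \<exists>g\<in>V \<inter> linear_forms R M. \<forall>x\<in>S. g x = f x"
    using \<Phi>(3) by blast
  have "forms_factor R M F \<alpha>"
    unfolding forms_factor_def
  proof
    fix f assume f: "f \<in> linear_forms R M"
    then obtain g where g: "g \<in> V" "\<forall>x\<in>S. g x = f x" using VH by blast
    then have gl: "g \<in> linear_forms R M" by (simp add: V_def)
    \<comment> \<open>Agreement is known only on S; it spreads to M because S generates.\<close>
    have "{x \<in> carrier M. g x = f x} = carrier M"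
      using g(2) S(2)
      by (intro S(3) submodule_equalizer[OF M.module_axioms self.module_axioms gl f]) auto
    then have "\<forall>x\<in>carrier M. g x = f x" by blast
    then show "\<exists>h\<in>linear_forms R F. \<forall>x\<in>carrier M. f x = h (\<alpha> x)"
      using g(1) by (auto simp: V_def)
  qed
  with F \<alpha>(1) show ?thesis by (rule that)
qed

text \<open>A target D is a retract of some R^n. The coordinates of \<open>s \<circ> g\<close> are
  forms and factor one by one; the factors assemble to a map into R^n, and \<pi> brings it back to
  D.\<close>

lemma preenvelope_forms_factor:
  fixes M F :: "('a, 'm) module"
  assumes M: "module R M" and F: "coordinates R k F p" and \<alpha>: "\<alpha> \<in> lin_map R M F"
    and ff: "forms_factor R M F \<alpha>"
    and ex: "\<And>k. \<exists>(F :: ('a, 'm) module) p. coordinates R k F p"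
  shows "preenvelope R (fg_projective R) M F \<alpha>"
  unfolding preenvelope_def mod_hom_eq_lin_map
proof (intro conjI allI ballI impI)
  show "fg_projective R F" by (rule fg_projective_coordinates[OF F])
  show "\<alpha> \<in> lin_map R M F" by fact
  fix D :: "('a, 'm) module" and g
  assume g: "g \<in> lin_map R M D" and D: "fg_projective R D"
  interpret M: module R M by fact
  interpret F: module R F by (rule coordinates_module[OF F])
  obtain n and G :: "('a, 'm) module" and q s \<pi> where G: "coordinates R n G q"
    and s: "s \<in> lin_map R D G" and \<pi>: "\<pi> \<in> lin_map R G D" "\<And>x. x \<in> carrier D \<Longrightarrow> \<pi> (s x) = x"
    by (rule fg_projective_retract[OF D ex]) (rule that)
  have sg: "(\<lambda>x. s (g x)) \<in> lin_map R M G" by (rule lin_map_compose[OF g s])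
  have "\<exists>h. h \<in> linear_forms R F \<and> (\<forall>x\<in>carrier M. q i (s (g x)) = h (\<alpha> x))" if "i < n" for i
  proof -
    have "(\<lambda>x. q i (s (g x))) \<in> linear_forms R M"
      by (rule lin_map_compose[OF sg coordinates_form[OF G that]])
    from ff[unfolded forms_factor_def, THEN bspec, OF this] show ?thesis by blast
  qed
  then have "\<forall>i\<in>{..<n}. \<exists>h. h \<in> linear_forms R F \<and> (\<forall>x\<in>carrier M. q i (s (g x)) = h (\<alpha> x))"
    by simp
  from bchoice[OF this] obtain h where
    "\<forall>i\<in>{..<n}. h i \<in> linear_forms R F \<and> (\<forall>x\<in>carrier M. q i (s (g x)) = h i (\<alpha> x))" ..
  then have h: "\<And>i. i < n \<Longrightarrow> h i \<in> linear_forms R F"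
    "\<And>i x. i < n \<Longrightarrow> x \<in> carrier M \<Longrightarrow> q i (s (g x)) = h i (\<alpha> x)" by simp_all
  obtain f where f: "f \<in> lin_map R F G" "\<And>x i. x \<in> carrier F \<Longrightarrow> i < n \<Longrightarrow> q i (f x) = h i x"
    by (rule coordinates_product[OF G F.module_axioms, of h]) (rule h that | assumption)+
  have "g x = \<pi> (f (\<alpha> x))" if x: "x \<in> carrier M" for x
  proof -
    have "s (g x) = f (\<alpha> x)"
      by (rule coordinates_eqI[OF G])
        (simp_all add: lin_map_closed[OF sg] lin_map_closed[OF f(1)] lin_map_closed[OF \<alpha>] x h(2) f(2))
    then show ?thesis using \<pi>(2)[OF lin_map_closed[OF g x]] by simp
  qed
  then show "\<exists>h\<in>lin_map R F D. \<forall>x\<in>carrier M. g x = h (\<alpha> x)"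
    by (intro bexI[OF _ lin_map_compose[OF f(1) \<pi>(1)]] ballI)
qed

text \<open>Coordinates of the image of a torsion element are killed by a nonzero scalar, hence
  zero. A non-torsion element has a form not vanishing on it, and this form factors through
  \<alpha>.\<close>

lemma forms_factor_kernel:
  assumes R: "domain R" and fg: "fin_gen R M" and F: "coordinates R k F p"
    and \<alpha>: "\<alpha> \<in> lin_map R M F" and ff: "forms_factor R M F \<alpha>" and x: "x \<in> carrier M"
  shows "\<alpha> x = \<zero>\<^bsub>F\<^esub> \<longleftrightarrow> torsion R M x"
proof -
  interpret domain R by fact
  interpret M: module R M using fg by (simp add: fin_gen_def)
  interpret F: module R F by (rule coordinates_module[OF F])
  have form0: "f \<zero>\<^bsub>F\<^esub> = \<zero>\<^bsub>R\<^esub>" if "f \<in> linear_forms R F" for f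
    using lin_map_zero[OF F.module_axioms module_self_module that] by simp
  have \<alpha>x: "\<alpha> x \<in> carrier F" by (rule lin_map_closed[OF \<alpha> x])
  show ?thesis
  proof
    assume 0: "\<alpha> x = \<zero>\<^bsub>F\<^esub>"
    show "torsion R M x"
    proof (rule ccontr)
      assume "\<not> torsion R M x"
      then obtain \<phi> where "\<phi> \<in> linear_forms R M" "\<phi> x \<noteq> \<zero>\<^bsub>R\<^esub>"
        by (rule exists_form_nonzero[OF R fg x])
      then show False using ff x 0 form0 unfolding forms_factor_def by metis
    qed
  next
    assume "torsion R M x"
    then obtain r where r: "r \<in> carrier R" "r \<noteq> \<zero>\<^bsub>R\<^esub>" "r \<odot>\<^bsub>M\<^esub> x = \<zero>\<^bsub>M\<^esub>"
      by (auto simp: torsion_def)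
    show "\<alpha> x = \<zero>\<^bsub>F\<^esub>"
    proof (rule coordinates_eqI[OF F \<alpha>x F.zero_closed])
      fix i assume i: "i < k"
      note p = coordinates_form[OF F i]
      have "r \<otimes>\<^bsub>R\<^esub> p i (\<alpha> x) = p i (\<alpha> (r \<odot>\<^bsub>M\<^esub> x))"
        using lin_map_smult[OF p r(1) \<alpha>x] lin_map_smult[OF \<alpha> r(1) x] by simp
      also have "\<dots> = \<zero>\<^bsub>R\<^esub>"
        using lin_map_zero[OF M.module_axioms F.module_axioms \<alpha>] form0[OF p] r(3) by simp
      finally have "p i (\<alpha> x) = \<zero>\<^bsub>R\<^esub>"
        using r integral coordinates_closed[OF F i \<alpha>x] by blast
      then show "p i (\<alpha> x) = p i \<zero>\<^bsub>F\<^esub>" using form0[OF p] by simp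
    qed
  qed
qed

section \<open>Differences, images and sums of submodules\<close>

text \<open>The difference uses the scalar -1 because the additive inverse of a module record
  depends on its carrier, while addition and scalar multiplication do not. So the same element
  serves M and its submodules.\<close>

lemma lin_map_eq_iff:
  assumes M: "module R M" and N: "module R N" and f: "f \<in> lin_map R M N"
    and xy: "x \<in> carrier M" "y \<in> carrier M"
  shows "f x = f y \<longleftrightarrow> f (x \<oplus>\<^bsub>M\<^esub> (\<ominus>\<^bsub>R\<^esub> \<one>\<^bsub>R\<^esub>) \<odot>\<^bsub>M\<^esub> y) = \<zero>\<^bsub>N\<^esub>"
proof -
  interpret M: module R M by fact
  interpret N: module R N by fact
  have "f (x \<oplus>\<^bsub>M\<^esub> (\<ominus>\<^bsub>R\<^esub> \<one>\<^bsub>R\<^esub>) \<odot>\<^bsub>M\<^esub> y) = f x \<ominus>\<^bsub>N\<^esub> f y"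
    using xy lin_map_closed[OF f]
    by (simp add: lin_map_add[OF f] lin_map_smult[OF f] N.smult_l_minus a_minus_def)
  moreover have "f x \<ominus>\<^bsub>N\<^esub> f y = \<zero>\<^bsub>N\<^esub> \<longleftrightarrow> f x = f y"
    using lin_map_closed[OF f xy(1)] lin_map_closed[OF f xy(2)]
    by (metis a_minus_def N.M.add.inv_closed N.M.minus_equality N.M.minus_minus N.M.r_neg)
  ultimately show ?thesis by simp
qed

lemma submodule_trans:
  assumes M: "module R M" and N: "submodule N R M" and K: "submodule K R (M\<lparr>carrier := N\<rparr>)"
  shows "submodule K R M"
proof -
  interpret M: module R M by fact
  interpret N: module R "M\<lparr>carrier := N\<rparr>" by (rule submodule.submodule_is_module[OF N M])
  show ?thesis
    by (rule M.submoduleI')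
      (use M.submoduleE(1)[OF N] N.submoduleE[OF K] N.submodule_zero_closed[OF K] in auto)
qed

lemma submodule_Int:
  assumes M: "module R M" and N: "submodule N R M" and K: "submodule K R M"
  shows "submodule (N \<inter> K) R M"
proof -
  interpret M: module R M by fact
  show ?thesis
    by (rule M.submoduleI')
      (use M.submoduleE[OF N] M.submoduleE[OF K] M.submodule_zero_closed N K in auto)
qed

text \<open>Tests generation of N by submodules of the ambient M, so that different submodules can
  be compared. A test submodule K of M becomes one of N by intersection.\<close>

lemma fin_gen_submodule_iff:
  assumes M: "module R M" and N: "submodule N R M"
  shows "fin_gen R (M\<lparr>carrier := N\<rparr>) \<longleftrightarrow>
    (\<exists>S. finite S \<and> S \<subseteq> N \<and> (\<forall>K. submodule K R M \<and> S \<subseteq> K \<longrightarrow> N \<subseteq> K))" (is "?L \<longleftrightarrow> ?R")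
proof
  interpret N: module R "M\<lparr>carrier := N\<rparr>" by (rule submodule.submodule_is_module[OF N M])
  { assume ?L
    then obtain S where S: "finite S" "S \<subseteq> N"
      "\<And>K. submodule K R (M\<lparr>carrier := N\<rparr>) \<Longrightarrow> S \<subseteq> K \<Longrightarrow> K = N"
      unfolding fin_gen_def by auto
    have "N \<subseteq> K" if K: "submodule K R M" "S \<subseteq> K" for K
    proof -
      have "N \<inter> K = N"
        using S(2) K(2)
        by (intro S(3) submodule_restrict[OF M submodule_Int[OF M N K(1)] N]) auto
      then show ?thesis by blast
    qed
    with S(1,2) show ?R by blast }
  { assume ?R
    then obtain S where S: "finite S" "S \<subseteq> N"
      "\<forall>K. submodule K R M \<and> S \<subseteq> K \<longrightarrow> N \<subseteq> K" by (elim exE conjE)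
    have "K = N" if K: "submodule K R (M\<lparr>carrier := N\<rparr>)" "S \<subseteq> K" for K
      using S(3)[THEN spec, THEN mp, OF conjI[OF submodule_trans[OF M N K(1)] K(2)]]
        N.submoduleE(1)[OF K(1)] by auto
    with S(1,2) N.module_axioms show ?L unfolding fin_gen_def by auto }
qed

lemma fin_gen_image:
  assumes fg: "fin_gen R M" and N: "module R N" and f: "f \<in> mod_hom R M N"
  shows "fin_gen R (N\<lparr>carrier := f ` carrier M\<rparr>)"
proof -
  interpret M: module R M using fg by (simp add: fin_gen_def)
  have f': "f \<in> lin_map R M N" using f by (simp add: mod_hom_eq_lin_map)
  obtain S where S: "finite S" "S \<subseteq> carrier M"
    "\<And>K. submodule K R M \<Longrightarrow> S \<subseteq> K \<Longrightarrow> K = carrier M"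
    using fg unfolding fin_gen_def by blast
  have "f ` carrier M \<subseteq> K" if K: "submodule K R N" "f ` S \<subseteq> K" for K
    using S(3)[OF submodule_vimage[OF M.module_axioms N f' K(1)]] S(2) K(2) by blast
  then show ?thesis
    unfolding fin_gen_submodule_iff[OF N
        mod_hom_image_submodule[OF M.module_axioms N f M.carrier_is_submodule]]
    using S(1,2) by (intro exI[of _ "f ` S"]) auto
qed

lemma exists_fin_gen_sum:
  assumes M: "module R M" and U: "submodule U R M" "fin_gen R (M\<lparr>carrier := U\<rparr>)"
    and W: "submodule W R M" "fin_gen R (M\<lparr>carrier := W\<rparr>)"
  obtains V where "submodule V R M" "fin_gen R (M\<lparr>carrier := V\<rparr>)" "U \<subseteq> V" "W \<subseteq> V"
proof -
  interpret M: module R M by fact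
  note Uc = M.submoduleE[OF U(1)] M.submodule_zero_closed[OF U(1)]
  note Wc = M.submoduleE[OF W(1)] M.submodule_zero_closed[OF W(1)]
  define V where "V = {u \<oplus>\<^bsub>M\<^esub> w | u w. u \<in> U \<and> w \<in> W}"
  have UV: "U \<subseteq> V"
  proof
    fix u assume u: "u \<in> U"
    then have "u = u \<oplus>\<^bsub>M\<^esub> \<zero>\<^bsub>M\<^esub>" using Uc(1) by (simp add: subsetD)
    then show "u \<in> V" using u Wc(7) unfolding V_def by blast
  qed
  have WV: "W \<subseteq> V"
  proof
    fix w assume w: "w \<in> W"
    then have "w = \<zero>\<^bsub>M\<^esub> \<oplus>\<^bsub>M\<^esub> w" using Wc(1) by (simp add: subsetD)
    then show "w \<in> V" using w Uc(7) unfolding V_def by blast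
  qed
  have V: "submodule V R M"
  proof (rule M.submoduleI')
    show "V \<subseteq> carrier M" using Uc(1) Wc(1) by (auto simp: V_def)
    show "\<zero>\<^bsub>M\<^esub> \<in> V" using UV Uc(7) by blast
    show "a \<oplus>\<^bsub>M\<^esub> b \<in> V" if "a \<in> V" "b \<in> V" for a b
    proof -
      obtain u w u' w' where *: "u \<in> U" "w \<in> W" "u' \<in> U" "w' \<in> W"
        "a = u \<oplus>\<^bsub>M\<^esub> w" "b = u' \<oplus>\<^bsub>M\<^esub> w'" using \<open>a \<in> V\<close> \<open>b \<in> V\<close> unfolding V_def by blast
      have "a \<oplus>\<^bsub>M\<^esub> b = (u \<oplus>\<^bsub>M\<^esub> u') \<oplus>\<^bsub>M\<^esub> (w \<oplus>\<^bsub>M\<^esub> w')"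
        using * Uc(1) Wc(1) by (simp add: subsetD M.a_ac)
      then show ?thesis using * Uc(5) Wc(5) unfolding V_def by blast
    qed
    show "r \<odot>\<^bsub>M\<^esub> a \<in> V" if "r \<in> carrier R" "a \<in> V" for r a
    proof -
      obtain u w where *: "u \<in> U" "w \<in> W" "a = u \<oplus>\<^bsub>M\<^esub> w" using \<open>a \<in> V\<close> unfolding V_def by blast
      then have "r \<odot>\<^bsub>M\<^esub> a = r \<odot>\<^bsub>M\<^esub> u \<oplus>\<^bsub>M\<^esub> r \<odot>\<^bsub>M\<^esub> w"
        using Uc(1) Wc(1) that(1) by (simp add: subsetD M.smult_r_distr)
      then show ?thesis using * Uc(4) Wc(4) that(1) unfolding V_def by blast
    qed
  qed
  obtain S where S: "finite S" "S \<subseteq> U" "\<forall>K. submodule K R M \<and> S \<subseteq> K \<longrightarrow> U \<subseteq> K"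
    using U(2) unfolding fin_gen_submodule_iff[OF M U(1)] by (elim exE conjE)
  obtain T where T: "finite T" "T \<subseteq> W" "\<forall>K. submodule K R M \<and> T \<subseteq> K \<longrightarrow> W \<subseteq> K"
    using W(2) unfolding fin_gen_submodule_iff[OF M W(1)] by (elim exE conjE)
  have "V \<subseteq> K" if K: "submodule K R M" "S \<union> T \<subseteq> K" for K
  proof -
    have "U \<subseteq> K" "W \<subseteq> K" using S(3) T(3) K by auto
    then show ?thesis using M.submoduleE(5)[OF K(1)] unfolding V_def by blast
  qed
  then have "fin_gen R (M\<lparr>carrier := V\<rparr>)"
    unfolding fin_gen_submodule_iff[OF M V] using S(1,2) T(1,2) UV WV
    by (intro exI[of _ "S \<union> T"]) auto
  with V UV WV that show ?thesis by blast
qed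

section \<open>Functoriality and monotonicity of the preenvelope closure\<close>

text \<open>The map \<beta> \<circ> f factors through \<alpha> by some h between the preenvelopes,
  and functoriality of \<open>cl\<close> along h gives the claim.\<close>

lemma preenvelope_closure_functorial:
  fixes M M' :: "('a, 'm) module"
  assumes Q: "\<And>P. Q P \<Longrightarrow> module R P" and fn: "functorial_closure R Q cl"
    and M: "module R M" and M': "module R M'"
    and a: "preenvelope R Q M C \<alpha>" and b: "preenvelope R Q M' D \<beta>"
    and f: "f \<in> mod_hom R M M'" and L: "submodule L R M"
    and x: "x \<in> preenvelope_closure R Q cl M L"
  shows "f x \<in> preenvelope_closure R Q cl M' (f ` L)"
proof -
  have C: "Q C" "\<alpha> \<in> mod_hom R M C" and D: "Q D" "\<beta> \<in> mod_hom R M' D"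
    using a b by (auto simp: preenvelope_def)
  have LM: "L \<subseteq> carrier M" using module.submoduleE(1)[OF M L] .
  note closure_eq = preenvelope_closure_eq[of Q R cl, OF _ fn]
  have "preenvelope_closure R Q cl M L = {x \<in> carrier M. \<alpha> x \<in> cl C (\<alpha> ` L)}"
    by (rule closure_eq[OF _ M L a]) (rule Q)
  with x have x: "x \<in> carrier M" "\<alpha> x \<in> cl C (\<alpha> ` L)" by auto
  have "(\<lambda>x. \<beta> (f x)) \<in> mod_hom R M D"
    using lin_map_compose f D(2) unfolding mod_hom_eq_lin_map by blast
  moreover have "\<forall>D. \<forall>g\<in>mod_hom R M D. Q D \<longrightarrow>
      (\<exists>h\<in>mod_hom R C D. \<forall>x\<in>carrier M. g x = h (\<alpha> x))"
    using a unfolding preenvelope_def by (elim conjE)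
  ultimately have "\<exists>h\<in>mod_hom R C D. \<forall>x\<in>carrier M. \<beta> (f x) = h (\<alpha> x)"
    using D(1) by (elim allE[of _ D] ballE[of _ _ "\<lambda>x. \<beta> (f x)"]) simp_all
  then obtain h where h: "h \<in> mod_hom R C D" "\<forall>x\<in>carrier M. \<beta> (f x) = h (\<alpha> x)" ..
  have "submodule (\<alpha> ` L) R C" by (rule mod_hom_image_submodule[OF M Q[OF C(1)] C(2) L])
  then have "h ` cl C (\<alpha> ` L) \<subseteq> cl D (h ` \<alpha> ` L)"
    using fn h(1) C(1) D(1) unfolding functorial_closure_def by blast
  moreover have "h ` \<alpha> ` L = \<beta> ` f ` L" using h(2) LM by (force simp: image_iff)
  ultimately have "\<beta> (f x) \<in> cl D (\<beta> ` f ` L)" using h(2) x by auto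
  moreover have "f x \<in> carrier M'" using f x(1) by (auto simp: mod_hom_def)
  moreover have "preenvelope_closure R Q cl M' (f ` L)
      = {x \<in> carrier M'. \<beta> x \<in> cl D (\<beta> ` f ` L)}"
    by (rule closure_eq[OF _ M' mod_hom_image_submodule[OF M M' f L] b]) (rule Q)
  ultimately show ?thesis by blast
qed

lemma preenvelope_closure_mono:
  assumes Q: "\<And>P. Q P \<Longrightarrow> module R P" and cl: "closure_operation R Q cl"
    and fn: "functorial_closure R Q cl"
    and M: "module R M" and a: "preenvelope R Q M C \<alpha>"
    and L: "submodule L R M" and L': "submodule L' R M" and "L \<subseteq> L'"
  shows "preenvelope_closure R Q cl M L \<subseteq> preenvelope_closure R Q cl M L'"
proof -
  have C: "Q C" "\<alpha> \<in> mod_hom R M C" using a by (auto simp: preenvelope_def)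
  note im = mod_hom_image_submodule[OF M Q[OF C(1)] C(2)]
  have "cl C (\<alpha> ` L) \<subseteq> cl C (\<alpha> ` L')"
    using cl im[OF L] im[OF L'] C(1) image_mono[OF \<open>L \<subseteq> L'\<close>, of \<alpha>]
    unfolding closure_operation_def by blast
  moreover have "preenvelope_closure R Q cl M K = {x \<in> carrier M. \<alpha> x \<in> cl C (\<alpha> ` K)}"
    if "submodule K R M" for K
    by (rule preenvelope_closure_eq[OF _ fn M that a]) (rule Q)
  ultimately show ?thesis using L L' by blast
qed

section \<open>The closure is hereditary\<close>

text \<open>Only the kernel of the constructed preenvelope matters from here on, so the coordinates
  are forgotten.\<close>

lemma exists_preenvelope:
  fixes M :: "('a, 'm) module"
  assumes R: "noetherian_domain R"
    and ex: "\<And>k. \<exists>(F :: ('a, 'm) module) p. coordinates R k F p"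
    and fg: "fin_gen R M"
  obtains C :: "('a, 'm) module" and \<alpha> where "preenvelope R (fg_projective R) M C \<alpha>"
    "\<And>x. x \<in> carrier M \<Longrightarrow> \<alpha> x = \<zero>\<^bsub>C\<^esub> \<longleftrightarrow> torsion R M x"
proof -
  have R': "noetherian_ring R" "domain R" using R by (auto simp: noetherian_domain_def)
  have M: "module R M" using fg by (simp add: fin_gen_def)
  obtain k and F :: "('a, 'm) module" and p \<alpha> where F: "coordinates R k F p"
    and \<alpha>: "\<alpha> \<in> lin_map R M F" "forms_factor R M F \<alpha>"
    by (rule exists_forms_factor[OF R'(1) fg ex])
  show ?thesis
    by (rule that[OF preenvelope_forms_factor[OF M F \<alpha> ex]
          forms_factor_kernel[OF R'(2) fg F \<alpha>]])
qed

lemma preenvelope_closure_hereditary: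
  fixes R :: "('a, 'b) ring_scheme" and cl :: "('a, 'm) module \<Rightarrow> 'm set \<Rightarrow> 'm set"
  assumes R: "noetherian_domain R"
    and ex: "\<And>k. \<exists>(F :: ('a, 'm) module) p. coordinates R k F p"
    and fn: "functorial_closure R (fg_projective R) cl"
    and indep: "\<And>M P Q \<alpha> \<beta> L.
      \<lbrakk>module R M; fg_projective R P; fg_projective R Q;
       \<alpha> \<in> mod_hom R M P; inj_on \<alpha> (carrier M);
       \<beta> \<in> mod_hom R M Q; inj_on \<beta> (carrier M);
       submodule L R M\<rbrakk> \<Longrightarrow>
      {x \<in> carrier M. \<alpha> x \<in> cl P (\<alpha> ` L)} = {x \<in> carrier M. \<beta> x \<in> cl Q (\<beta> ` L)}"
  shows "hereditary_closure R (fin_gen R) (preenvelope_closure R (fg_projective R) cl)"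
  unfolding hereditary_closure_def
proof (intro allI impI, elim conjE)
  fix M :: "('a, 'm) module" and N L
  assume fgM: "fin_gen R M" and N: "submodule N R M" and fgN: "fin_gen R (M\<lparr>carrier := N\<rparr>)"
    and L: "submodule L R M" and LN: "L \<subseteq> N"
  let ?N = "M\<lparr>carrier := N\<rparr>" and ?d = "preenvelope_closure R (fg_projective R) cl"
  have fgp: "fg_projective R P \<Longrightarrow> module R P" for P :: "('a, 'm) module"
    by (simp add: fg_projective_def fin_gen_def)
  interpret M: module R M using fgM by (simp add: fin_gen_def)
  interpret N: module R ?N using fgN by (simp add: fin_gen_def)
  have NM: "N \<subseteq> carrier M" using M.submoduleE(1)[OF N] .
  have L': "submodule L R ?N" by (rule submodule_restrict[OF M.module_axioms L N LN])
  obtain C :: "('a, 'm) module" and \<alpha> where a: "preenvelope R (fg_projective R) M C \<alpha>"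
    "\<And>x. x \<in> carrier M \<Longrightarrow> \<alpha> x = \<zero>\<^bsub>C\<^esub> \<longleftrightarrow> torsion R M x"
    by (rule exists_preenvelope[OF R ex fgM]) (rule that)
  obtain D :: "('a, 'm) module" and \<beta> where b: "preenvelope R (fg_projective R) ?N D \<beta>"
    "\<And>x. x \<in> carrier ?N \<Longrightarrow> \<beta> x = \<zero>\<^bsub>D\<^esub> \<longleftrightarrow> torsion R ?N x"
    by (rule exists_preenvelope[OF R ex fgN]) (rule that)
  have C: "fg_projective R C" "\<alpha> \<in> lin_map R M C" and D: "fg_projective R D" "\<beta> \<in> lin_map R ?N D"
    using a(1) b(1) by (auto simp: preenvelope_def mod_hom_eq_lin_map)
  interpret C: module R C by (rule fgp[OF C(1)])
  interpret D: module R D by (rule fgp[OF D(1)])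
  have \<alpha>N: "\<alpha> \<in> lin_map R ?N C" by (rule lin_map_restrict[OF C(2) NM])
  have ker: "\<alpha> x = \<alpha> y \<longleftrightarrow> \<beta> x = \<beta> y" if "x \<in> N" "y \<in> N" for x y
  proof -
    let ?z = "x \<oplus>\<^bsub>?N\<^esub> (\<ominus>\<^bsub>R\<^esub> \<one>\<^bsub>R\<^esub>) \<odot>\<^bsub>?N\<^esub> y"
    have "?z \<in> carrier ?N" using that by (intro N.a_closed N.smult_closed) auto
    moreover from this have "?z \<in> carrier M" using NM by auto
    \<comment> \<open>\<open>torsion\<close> does not mention the carrier, so it is the same
      predicate for N and for M.\<close>
    ultimately have "\<alpha> ?z = \<zero>\<^bsub>C\<^esub> \<longleftrightarrow> \<beta> ?z = \<zero>\<^bsub>D\<^esub>"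
      using a(2)[of ?z] b(2)[of ?z] by (simp add: torsion_def)
    then show ?thesis
      using that lin_map_eq_iff[OF N.module_axioms C.module_axioms \<alpha>N, of x y]
        lin_map_eq_iff[OF N.module_axioms D.module_axioms D(2), of x y] by simp
  qed
  let ?K = "C\<lparr>carrier := \<alpha> ` N\<rparr>"
  have KC: "submodule (\<alpha> ` N) R C"
    using mod_hom_image_submodule[OF M.module_axioms C.module_axioms _ N] C(2)
    by (simp add: mod_hom_eq_lin_map)
  have LC: "submodule (\<alpha> ` L) R C"
    using mod_hom_image_submodule[OF M.module_axioms C.module_axioms _ L] C(2)
    by (simp add: mod_hom_eq_lin_map)
  have LK: "submodule (\<alpha> ` L) R ?K"
    by (rule submodule_restrict[OF C.module_axioms LC KC]) (use LN in blast)
  interpret K: module R ?K by (rule submodule.submodule_is_module[OF KC C.module_axioms])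
  \<comment> \<open>The map induced by \<beta> on \<alpha>(N). By \<open>ker\<close> the choice of
    the preimage is irrelevant, and \<gamma> is injective.\<close>
  define \<gamma> where "\<gamma> z = \<beta> (inv_into N \<alpha> z)" for z
  have \<gamma>: "\<gamma> (\<alpha> x) = \<beta> x" if "x \<in> N" for x
    unfolding \<gamma>_def using that ker[of "inv_into N \<alpha> (\<alpha> x)" x]
    by (simp add: inv_into_into f_inv_into_f)
  have \<gamma>_lin: "\<gamma> \<in> lin_map R ?K D"
  proof (rule lin_mapI)
    show "\<gamma> z \<in> carrier D" if "z \<in> carrier ?K" for z
      using that lin_map_closed[OF D(2)] by (auto simp: \<gamma>)
    show "\<gamma> (y \<oplus>\<^bsub>?K\<^esub> z) = \<gamma> y \<oplus>\<^bsub>D\<^esub> \<gamma> z" if yz: "y \<in> carrier ?K" "z \<in> carrier ?K" for y z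
    proof -
      obtain u v where *: "u \<in> N" "v \<in> N" "y = \<alpha> u" "z = \<alpha> v" using yz by auto
      then have "y \<oplus>\<^bsub>C\<^esub> z = \<alpha> (u \<oplus>\<^bsub>M\<^esub> v)" "u \<oplus>\<^bsub>M\<^esub> v \<in> N"
        using lin_map_add[OF \<alpha>N, of u v] M.submoduleE(5)[OF N] by auto
      then show ?thesis using * lin_map_add[OF D(2), of u v] by (simp add: \<gamma>)
    qed
    show "\<gamma> (r \<odot>\<^bsub>?K\<^esub> z) = r \<odot>\<^bsub>D\<^esub> \<gamma> z" if rz: "r \<in> carrier R" "z \<in> carrier ?K" for r z
    proof -
      obtain v where *: "v \<in> N" "z = \<alpha> v" using rz by auto
      then have "r \<odot>\<^bsub>C\<^esub> z = \<alpha> (r \<odot>\<^bsub>M\<^esub> v)" "r \<odot>\<^bsub>M\<^esub> v \<in> N"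
        using rz(1) lin_map_smult[OF \<alpha>N, of r v] M.submoduleE(4)[OF N] by auto
      then show ?thesis using * rz(1) lin_map_smult[OF D(2), of r v] by (simp add: \<gamma>)
    qed
  qed
  have \<gamma>_inj: "inj_on \<gamma> (carrier ?K)"
    by (rule inj_onI) (auto simp: \<gamma> ker)
  have \<gamma>L: "\<gamma> ` \<alpha> ` L = \<beta> ` L" using \<gamma> LN by (force simp: image_iff)
  have id_lin: "(\<lambda>x. x) \<in> lin_map R ?K C"
    by (rule lin_map_restrict[OF lin_map_id]) (use C.submoduleE(1)[OF KC] in simp)
  \<comment> \<open>Independence for the module \<alpha>(N), with its inclusion into C and with
    \<gamma> into D as the two embeddings.\<close>
  have "{x \<in> carrier ?K. x \<in> cl C ((\<lambda>x. x) ` \<alpha> ` L)} = {x \<in> carrier ?K. \<gamma> x \<in> cl D (\<gamma> ` \<alpha> ` L)}"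
    by (rule indep[OF K.module_axioms C(1) D(1) _ _ _ \<gamma>_inj LK])
      (use id_lin \<gamma>_lin in \<open>simp_all add: mod_hom_eq_lin_map\<close>)
  note indep_K = this
  have key: "\<alpha> x \<in> cl C (\<alpha> ` L) \<longleftrightarrow> \<beta> x \<in> cl D (\<beta> ` L)" if "x \<in> N" for x
    using arg_cong[OF indep_K, of "\<lambda>A. \<alpha> x \<in> A"] that \<gamma>[OF that] unfolding \<gamma>L by simp
  have "?d M L = {x \<in> carrier M. \<alpha> x \<in> cl C (\<alpha> ` L)}"
    by (rule preenvelope_closure_eq[OF _ fn M.module_axioms L a(1)]) (rule fgp)
  moreover have "?d ?N L = {x \<in> carrier ?N. \<beta> x \<in> cl D (\<beta> ` L)}"
    by (rule preenvelope_closure_eq[OF _ fn N.module_axioms L' b(1)]) (rule fgp)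
  ultimately show "?d ?N L = ?d M L \<inter> N" using key NM by auto
qed

section \<open>Comparison with the hereditary version\<close>

text \<open>A formal consequence of the listed properties of d. An element of the closure in U is
  moved into a larger V by functoriality, L \<inter> U is enlarged to L by monotonicity, and
  heredity cuts V back to the image of M.\<close>

lemma hereditary_version_eq:
  assumes her: "hereditary_closure R (fin_gen R) d"
    and functorial: "\<And>M M' L f. \<lbrakk>fin_gen R M; fin_gen R M'; f \<in> mod_hom R M M'; submodule L R M\<rbrakk>
      \<Longrightarrow> f ` d M L \<subseteq> d M' (f ` L)"
    and mono: "\<And>M L L'. \<lbrakk>fin_gen R M; submodule L R M; submodule L' R M; L \<subseteq> L'\<rbrakk>
      \<Longrightarrow> d M L \<subseteq> d M L'"
    and subset: "\<And>M L. \<lbrakk>fin_gen R M; submodule L R M\<rbrakk> \<Longrightarrow> d M L \<subseteq> carrier M"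
    and fg: "fin_gen R M" and L: "submodule L R M"
    and E: "module R E" and i: "i \<in> mod_hom R M E" and inj: "inj_on i (carrier M)"
  shows "hereditary_version R d E i M L = d M L"
proof -
  interpret M: module R M using fg by (simp add: fin_gen_def)
  interpret E: module R E by fact
  let ?I = "i ` carrier M"
  let ?iM = "E\<lparr>carrier := ?I\<rparr>"
  have I: "submodule ?I R E"
    by (rule mod_hom_image_submodule[OF M.module_axioms E i M.carrier_is_submodule])
  have fgI: "fin_gen R ?iM" by (rule fin_gen_image[OF fg E i])
  have LM: "L \<subseteq> carrier M" using M.submoduleE(1)[OF L] .
  have iL: "submodule (i ` L) R E" by (rule mod_hom_image_submodule[OF M.module_axioms E i L])
  have iLI: "submodule (i ` L) R ?iM"
    by (rule submodule_restrict[OF E iL I]) (use LM in blast)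
  have i_lin: "i \<in> lin_map R M E" using i by (simp add: mod_hom_eq_lin_map)
  have i_co: "i \<in> mod_hom R M ?iM"
    using lin_map_corestrict[OF i_lin order_refl] by (simp add: mod_hom_eq_lin_map)
  \<comment> \<open>Since \<open>i\<close> need not be an inclusion, closures in M and in its image
    are matched by functoriality along \<open>i\<close> and its inverse \<open>j\<close>.\<close>
  define j where "j = inv_into (carrier M) i"
  have j: "j (i x) = x" if "x \<in> carrier M" for x
    using inj that by (simp add: j_def)
  have j_lin: "j \<in> mod_hom R ?iM M"
    unfolding mod_hom_eq_lin_map
    by (rule lin_mapI)
      (auto simp: j lin_map_add[OF i_lin, symmetric] lin_map_smult[OF i_lin, symmetric])
  have "(\<lambda>x. j (i x)) ` L = (\<lambda>x. x) ` L" by (rule image_cong) (use j LM in auto)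
  then have jL: "j ` i ` L = L" by (simp add: image_image)
  show ?thesis
  proof (intro equalityI subsetI)
    \<comment> \<open>The image of M is itself one of the finitely generated submodules in the
      union.\<close>
    fix x assume x: "x \<in> d M L"
    then have "x \<in> carrier M" using subset[OF fg L] by blast
    moreover have "i x \<in> d ?iM (i ` L)" using functorial[OF fg fgI i_co L] x by blast
    moreover have "i ` L \<inter> ?I = i ` L" using LM by blast
    ultimately show "x \<in> hereditary_version R d E i M L"
      unfolding hereditary_version_def finitistic_version_def using I fgI by force
  next
    fix x assume "x \<in> hereditary_version R d E i M L"
    then obtain U where x: "x \<in> carrier M" and U: "submodule U R E" "fin_gen R (E\<lparr>carrier := U\<rparr>)"
      and xU: "i x \<in> d (E\<lparr>carrier := U\<rparr>) (i ` L \<inter> U)"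
      unfolding hereditary_version_def finitistic_version_def by blast
    \<comment> \<open>U and the image of M need not be comparable, and heredity is available only
      inside one finitely generated module.\<close>
    obtain V where V: "submodule V R E" "fin_gen R (E\<lparr>carrier := V\<rparr>)" "U \<subseteq> V" "?I \<subseteq> V"
      by (rule exists_fin_gen_sum[OF E U I fgI])
    let ?V = "E\<lparr>carrier := V\<rparr>"
    have LU: "submodule (i ` L \<inter> U) R E" by (rule submodule_Int[OF E iL U(1)])
    have LU': "submodule (i ` L \<inter> U) R (E\<lparr>carrier := U\<rparr>)"
      by (rule submodule_restrict[OF E LU U(1)]) blast
    have LUV: "submodule (i ` L \<inter> U) R ?V"
      by (rule submodule_restrict[OF E LU V(1)]) (use V(3) in blast)
    have LV: "submodule (i ` L) R ?V"
      by (rule submodule_restrict[OF E iL V(1)]) (use V(4) LM in blast)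
    have IV: "submodule ?I R ?V" by (rule submodule_restrict[OF E I V(1,4)])
    have "(\<lambda>x. x) \<in> mod_hom R (E\<lparr>carrier := U\<rparr>) ?V"
      using V(3) by (auto simp: mod_hom_def)
    from functorial[OF U(2) V(2) this LU'] have "i x \<in> d ?V (i ` L \<inter> U)" using xU by auto
    then have "i x \<in> d ?V (i ` L)" using mono[OF V(2) LUV LV] by blast
    moreover have "d (?V\<lparr>carrier := ?I\<rparr>) (i ` L) = d ?V (i ` L) \<inter> ?I"
      by (rule her[unfolded hereditary_closure_def, rule_format])
        (use V(2) IV fgI LV image_mono[OF LM, of i] in simp)
    ultimately have "i x \<in> d ?iM (i ` L)" using x by simp
    then have "j (i x) \<in> d M (j ` i ` L)" using functorial[OF fgI fg j_lin iLI] by blast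
    then show "x \<in> d M L" by (simp add: j[OF x] jL)
  qed
qed

theorem proposition9p11:
  fixes R :: "('a, 'b) ring_scheme"
    and cl :: "('a, 'm) module \<Rightarrow> 'm set \<Rightarrow> 'm set"
  assumes "noetherian_domain R"
    and "infinite (UNIV :: 'm set)"
    and "\<exists>\<iota> :: 'a \<Rightarrow> 'm. inj_on \<iota> (carrier R)"
    and "closure_operation R (fg_projective R) cl"
    and "functorial_closure R (fg_projective R) cl"
    and "\<And>M P Q \<alpha> \<beta> L.
      \<lbrakk>module R M; fg_projective R P; fg_projective R Q;
       \<alpha> \<in> mod_hom R M P; inj_on \<alpha> (carrier M);
       \<beta> \<in> mod_hom R M Q; inj_on \<beta> (carrier M);
       submodule L R M\<rbrakk> \<Longrightarrow>
      {x \<in> carrier M. \<alpha> x \<in> cl P (\<alpha> ` L)} = {x \<in> carrier M. \<beta> x \<in> cl Q (\<beta> ` L)}"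
  shows "hereditary_closure R (fin_gen R) (preenvelope_closure R (fg_projective R) cl) \<and>
    (\<forall>M L E i. fin_gen R M \<and> submodule L R M \<and>
       injective R E \<and> i \<in> mod_hom R M E \<and> inj_on i (carrier M) \<longrightarrow>
       hereditary_version R (preenvelope_closure R (fg_projective R) cl) E i M L
         = preenvelope_closure R (fg_projective R) cl M L)"
proof -
  interpret noetherian_domain R by fact
  obtain \<iota> :: "'a \<Rightarrow> 'm" where "inj_on \<iota> (carrier R)" using assms(3) ..
  \<comment> \<open>The size assumptions on \<open>'m\<close> enter through this fact.\<close>
  then have ex: "\<exists>(F :: ('a, 'm) module) p. coordinates R k F p" for k
    by (rule exists_coordinates[OF assms(2)])
  let ?d = "preenvelope_closure R (fg_projective R) cl"
  have fgp: "fg_projective R P \<Longrightarrow> module R P" for P :: "('a, 'm) module"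
    by (simp add: fg_projective_def fin_gen_def)
  have fgm: "fin_gen R M \<Longrightarrow> module R M" for M :: "('a, 'm) module"
    by (simp add: fin_gen_def)
  have pre: "\<exists>C \<alpha>. preenvelope R (fg_projective R) M C \<alpha>" if "fin_gen R M" for M :: "('a, 'm) module"
    by (rule exists_preenvelope[OF assms(1) ex that]) blast
  have her: "hereditary_closure R (fin_gen R) ?d"
    by (rule preenvelope_closure_hereditary[OF assms(1) ex assms(5,6)])
  have "hereditary_version R ?d E i M L = ?d M L"
    if *: "fin_gen R M" "submodule L R M" "injective R E" "i \<in> mod_hom R M E" "inj_on i (carrier M)"
    for M L E i
  proof (rule hereditary_version_eq[OF her _ _ _ *(1,2) _ *(4,5)])
    show "module R E" using *(3) by (simp add: injective_def)
    fix M :: "('a, 'm) module" and L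
    assume M: "fin_gen R M" and L: "submodule L R M"
    obtain C \<alpha> where a: "preenvelope R (fg_projective R) M C \<alpha>" using pre[OF M] by blast
    have "?d M L = {x \<in> carrier M. \<alpha> x \<in> cl C (\<alpha> ` L)}"
      by (rule preenvelope_closure_eq[OF _ assms(5) fgm[OF M] L a]) (rule fgp)
    then show "?d M L \<subseteq> carrier M" by blast
    show "?d M L \<subseteq> ?d M L'" if "submodule L' R M" "L \<subseteq> L'" for L'
      by (rule preenvelope_closure_mono[OF _ assms(4,5) fgm[OF M] a L that]) (rule fgp)
    show "f ` ?d M L \<subseteq> ?d M' (f ` L)" if M': "fin_gen R M'" and f: "f \<in> mod_hom R M M'" for M' :: "('a, 'm) module" and f
    proof -
      obtain D \<beta> where b: "preenvelope R (fg_projective R) M' D \<beta>" using pre[OF M'] by blast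
      have "f x \<in> ?d M' (f ` L)" if "x \<in> ?d M L" for x
        by (rule preenvelope_closure_functorial[OF _ assms(5) fgm[OF M] fgm[OF M'] a b f L that])
          (rule fgp)
      then show ?thesis by blast
    qed
  qed
  with her show ?thesis by blast
qed

end
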